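(* Let $\mathbb{K}$ be a field, $S=\mathbb{K}[x_1,\ldots,x_n]$, and let $m=x_{i_1}\cdots x_{i_s}\in S$ be a square-free monomial with $1\le i_1<\cdots<i_s\le n$. Let $T(m)=(t_k,\ldots,t_0)$ and suppose that $i_{t_k}<s$. Let $T'(m)=(t_{k_r},\ldots,t_{k_1})$, let $l$ be the largest index in $\{0,\ldots,k\}$ such that $i_{t_{k_1}}+1\leq t_l$, put $k_0=l$ (so $t_{k_0}=t_l$), and let $I=\mathrm{sfBorel}(m)$. Suppose that $$\frac{i_{t_{k_j}}-t_p+1}{i_{t_{k_j}}-t_{k_j}+1}+\frac{i_{t_p}-i_{t_{k_j}}}{i_{t_{k_{j-1}}}-t_{k_{j-1}}+1}\geq 1$$ for all $t_p\in T(m)$ and $j\in\{1,\ldots,r\}$ satisfying $t_{k_{j}}<t_p<t_{k_{j-1}}$. Then $$\widehat{\alpha}(I)= 1+\frac{s-i_{t_{k_1}}-1}{i_{t_l}-t_l+1}+\frac{i_{t_k}}{i_{t_{k}}-t_k+1}+\sum_{j=1}^{r-1}\frac{i_{t_{k_j}}-i_{t_{k_{j+1}}}}{i_{t_{k_j}}-t_{k_{j}}+1}.$$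
   Context: Square-free principal Borel ideal. For a monomial $m$, a Borel move of $m$ is a monomial $m\cdot\frac{x_{a_1}}{x_{b_1}}\cdots\frac{x_{a_q}}{x_{b_q}}$ with $a_p<b_p$ and $x_{b_p}\mid m$ for all $p$ (the trivial move giving $m$ itself is allowed). For a square-free monomial $m$, $\mathrm{sfBorel}(m)$ is the ideal of $S$ generated by all square-free monomials that are Borel moves of $m$; equivalently, for $m=x_{i_1}\cdots x_{i_s}$ with $i_1<\cdots<i_s$, it is generated by all $x_{j_1}\cdots x_{j_s}$ with $j_1<\cdots<j_s$ and $j_p\le i_p$ for all $p$. Waldschmidt constant. For a square-free monomial ideal $L\subseteq S$ with minimal primary decomposition $L=P_1\cap\cdots\cap P_t$ (the $P_i$ prime), the $q$-th symbolic power is $L^{(q)}=P_1^q\cap\cdots\cap P_t^q$. Write $\alpha(J)$ for the smallest degree of a generator of a homogeneous ideal $J$. Then $\widehat{\alpha}(L)=\lim_{q\to\infty}\alpha(L^{(q)})/q$. The tuple $T(m)$. For $m=x_{i_1}\cdots x_{i_s}$ with $i_1<\cdots<i_s$, put $t_0=s$ and, once $t_{q-1}$ is defined, put $t_q=\max\{j: 1\le j<t_{q-1},\ i_j<i_{j+1}-1\}$, stopping when this set is empty; the last one defined is $t_k$. Write $T(m)=(t_k,\ldots,t_0)$, so $t_k<t_{k-1}<\cdots<t_0=s$. The subsequence $T'(m)$ (defined when $i_{t_k}<s$). Define elements $t_1'<t_2'<\cdots<t_r'$ of $T(m)$ inductively: $t_1'=t_k$; given $t_j'$, let $t_{j+1}'$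 be the smallest element $t$ of $T(m)$ such that $i_{t_j'}<t$ and $i_t\le s-1$, stopping if there is none. So $i_{t_j'}\le s-1$ for all $1\le j\le r$. One writes $T'(m)=(t_{k_r},\ldots,t_{k_1})$ where $t_{k_j}=t'_{r-j+1}$; thus $t_{k_r}=t_k$ and $t_{k_r}<\cdots<t_{k_1}$. Since $i_{t_{k_1}}+1\le s=t_0$, an index $l$ with $i_{t_{k_1}}+1\le t_l$ exists. *)

theory Defs
  imports Complex_Main "HOL-Library.Poly_Mapping" "HOL-Algebra.Ideal_Product"
begin

text \<open>
  A monomial is its exponent vector, a finitely supported function on the variable indices.
  Polynomials over \<open>'k\<close> in all variables \<open>x\<^sub>0, x\<^sub>1, \<dots>\<close> form the type \<open>'k mpoly\<close>; the ring
  \<open>K[x\<^sub>1, \<dots>, x\<^sub>n]\<close> is its subring cut out by the carrier of \<open>poly_ring n\<close>.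
\<close>

type_synonym monom = "nat \<Rightarrow>\<^sub>0 nat"
type_synonym 'k mpoly = "monom \<Rightarrow>\<^sub>0 'k"

definition poly_ring :: "nat \<Rightarrow> ('k::field) mpoly ring" where
  "poly_ring n = \<lparr> carrier = {p. \<forall>u\<in>Poly_Mapping.keys p. Poly_Mapping.keys u \<subseteq> {1..n}},
                   mult = (*), one = 1, zero = 0, add = (+) \<rparr>"

definition mdeg :: "monom \<Rightarrow> nat" where
  "mdeg u = (\<Sum>x\<in>Poly_Mapping.keys u. Poly_Mapping.lookup u x)"

definition homogeneous :: "nat \<Rightarrow> ('k::field) mpoly \<Rightarrow> bool" where
  "homogeneous d p \<longleftrightarrow> (\<forall>u\<in>Poly_Mapping.keys p. mdeg u = d)"

definition var :: "nat \<Rightarrow> monom" where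
  "var x = Poly_Mapping.single x 1"

definition squarefree_monom :: "monom \<Rightarrow> bool" where
  "squarefree_monom u \<longleftrightarrow> (\<forall>x. Poly_Mapping.lookup u x \<le> 1)"

text \<open>
  The list \<open>ps\<close> holds the pairs \<open>(a\<^sub>p, b\<^sub>p)\<close>. The equation says \<open>m' = m \<cdot> \<Prod> x\<^bsub>a\<^sub>p\<^esub> / \<Prod> x\<^bsub>b\<^sub>p\<^esub>\<close>
  after clearing denominators, so it also forces the quotient to be a monomial.
\<close>

definition borel_move :: "monom \<Rightarrow> monom \<Rightarrow> bool" where
  "borel_move m m' \<longleftrightarrow>
     (\<exists>ps. (\<forall>(a, b)\<in>set ps. 1 \<le> a \<and> a < b \<and> b \<in> Poly_Mapping.keys m) \<and>
           m' + sum_list (map (\<lambda>(a, b). var b) ps) = m + sum_list (map (\<lambda>(a, b). var a) ps))"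

definition sfBorel :: "nat \<Rightarrow> monom \<Rightarrow> ('k::field) mpoly set" where
  "sfBorel n m = genideal (poly_ring n)
     {Poly_Mapping.single m' 1 | m'. borel_move m m' \<and> squarefree_monom m'}"

text \<open>
  For prime components, minimality of a primary decomposition means irredundancy only: the
  components are their own radicals, so distinctness of radicals is automatic for a set \<open>Ps\<close>.
  The intersection with the carrier matters only for \<open>Ps = {}\<close>.
\<close>

definition min_prime_decomp :: "('a, 'b) ring_scheme \<Rightarrow> 'a set \<Rightarrow> 'a set set \<Rightarrow> bool" where
  "min_prime_decomp R L Ps \<longleftrightarrow>
     finite Ps \<and> (\<forall>P\<in>Ps. primeideal P R) \<and> L = carrier R \<inter> \<Inter>Ps \<and>
     (\<forall>P\<in>Ps. L \<noteq> carrier R \<inter> \<Inter>(Ps - {P}))"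

lemma prime_contains_component:
  assumes "primeideal Q R" "finite Ps" "\<And>P. P \<in> Ps \<Longrightarrow> ideal P R" "carrier R \<inter> \<Inter>Ps \<subseteq> Q"
  shows "\<exists>P\<in>Ps. P \<subseteq> Q"
  using assms(2-4)
proof (induction Ps)
  case empty
  interpret Q: primeideal Q R by (fact assms(1))
  show ?case using empty Q.I_notcarr Q.a_subset by auto
next
  case (insert P Ps)
  interpret Q: primeideal Q R by (fact assms(1))
  interpret P: ideal P R using insert.prems by simp
  show ?case
  proof (rule ccontr)
    assume neg: "\<not> ?case"
    then have "\<not> carrier R \<inter> \<Inter>Ps \<subseteq> Q"
      using insert.IH insert.prems(1) by blast
    then obtain y where y: "y \<in> carrier R" "\<And>P'. P' \<in> Ps \<Longrightarrow> y \<in> P'" "y \<notin> Q" by blast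
    obtain x where x: "x \<in> P" "x \<notin> Q" using neg by blast
    have xc: "x \<in> carrier R" using x P.a_subset by blast
    have "x \<otimes>\<^bsub>R\<^esub> y \<in> P'" if "P' \<in> insert P Ps" for P'
      using that x y xc insert.prems(1) ideal.I_l_closed P.I_r_closed by fastforce
    moreover have "x \<otimes>\<^bsub>R\<^esub> y \<in> carrier R" using xc y by simp
    ultimately have "x \<otimes>\<^bsub>R\<^esub> y \<in> Q" using insert.prems(2) by blast
    then show False using Q.I_prime xc x y by blast
  qed
qed

lemma min_prime_decomp_subset:
  assumes "min_prime_decomp R L Ps" "min_prime_decomp R L Qs"
  shows "Ps \<subseteq> Qs"
proof
  fix P assume P: "P \<in> Ps"
  have id: "\<And>P. P \<in> Ps \<union> Qs \<Longrightarrow> ideal P R" and fin: "finite Ps" "finite Qs"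
    using assms by (auto simp: min_prime_decomp_def primeideal_def)
  have LP: "L = carrier R \<inter> \<Inter>Ps" and LQ: "L = carrier R \<inter> \<Inter>Qs"
    using assms by (auto simp: min_prime_decomp_def)
  have prm: "primeideal P R" if "P \<in> Ps \<union> Qs" for P
    using that assms by (auto simp: min_prime_decomp_def)
  have "carrier R \<inter> \<Inter>Qs \<subseteq> P" using LP LQ P by blast
  then obtain Q where Q: "Q \<in> Qs" "Q \<subseteq> P"
    using prime_contains_component[of P R Qs] P prm id fin by blast
  have "carrier R \<inter> \<Inter>Ps \<subseteq> Q" using LP LQ Q by blast
  then obtain P' where P': "P' \<in> Ps" "P' \<subseteq> Q"
    using prime_contains_component[of Q R Ps] Q prm id fin by blast
  have "P' = P"
  proof (rule ccontr)
    assume "P' \<noteq> P"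
    then have "L = carrier R \<inter> \<Inter>(Ps - {P})" using LP P' Q by blast
    then show False using assms(1) P by (auto simp: min_prime_decomp_def)
  qed
  then show "P \<in> Qs" using P' Q by auto
qed

lemma min_prime_decomp_unique:
  "min_prime_decomp R L Ps \<Longrightarrow> min_prime_decomp R L Qs \<Longrightarrow> Ps = Qs"
  by (simp add: min_prime_decomp_subset subset_antisym)

text \<open>
  The power \<open>P\<^sup>q\<close> is taken in the monoid of ideals under the ideal product. The description
  operator is justified by \<open>min_prime_decomp_unique\<close>.
\<close>

definition symbolic_power :: "('a, 'b) ring_scheme \<Rightarrow> 'a set \<Rightarrow> nat \<Rightarrow> 'a set" where
  "symbolic_power R L q =
     carrier R \<inter> (\<Inter>P\<in>(THE Ps. min_prime_decomp R L Ps). P [^]\<^bsub>ideals_set R\<^esub> q)"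

text \<open>
  The smallest degree of a generator, over all generating sets of \<open>J\<close> by nonzero homogeneous
  elements.
\<close>

definition alpha :: "nat \<Rightarrow> ('k::field) mpoly set \<Rightarrow> nat" where
  "alpha n J = (LEAST d. \<exists>G. G \<subseteq> carrier (poly_ring n) - {0} \<and> (\<forall>g\<in>G. \<exists>e. homogeneous e g) \<and>
                             J = genideal (poly_ring n) G \<and> (\<exists>g\<in>G. homogeneous d g))"

definition alpha_ratio :: "nat \<Rightarrow> ('k::field) mpoly set \<Rightarrow> nat \<Rightarrow> real" where
  "alpha_ratio n L q = real (alpha n (symbolic_power (poly_ring n) L q)) / real q"

definition waldschmidt :: "nat \<Rightarrow> ('k::field) mpoly set \<Rightarrow> real" where
  "waldschmidt n L = lim (alpha_ratio n L)"

text \<open>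
  Throughout, \<open>i 1 < \<dots> < i s\<close> are the indices of the variables of \<open>m\<close>. A sequence that stops is
  a total function whose values are meaningful up to its last index (\<open>T_last\<close>, resp.
  \<open>T'_length - 1\<close>), where the set of candidates for the next term first becomes empty.
\<close>

definition monom_of :: "(nat \<Rightarrow> nat) \<Rightarrow> nat \<Rightarrow> monom" where
  "monom_of i s = (\<Sum>p=1..s. var (i p))"

definition T_cands :: "(nat \<Rightarrow> nat) \<Rightarrow> nat \<Rightarrow> nat set" where
  "T_cands i t = {j. 1 \<le> j \<and> j < t \<and> i j < i (j + 1) - 1}"

primrec T_seq :: "(nat \<Rightarrow> nat) \<Rightarrow> nat \<Rightarrow> nat \<Rightarrow> nat" where
  "T_seq i s 0 = s"
| "T_seq i s (Suc q) = Max (T_cands i (T_seq i s q))"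

definition T_last :: "(nat \<Rightarrow> nat) \<Rightarrow> nat \<Rightarrow> nat" where
  "T_last i s = (LEAST q. T_cands i (T_seq i s q) = {})"

definition T_set :: "(nat \<Rightarrow> nat) \<Rightarrow> nat \<Rightarrow> nat set" where
  "T_set i s = T_seq i s ` {0..T_last i s}"

definition T'_cands :: "(nat \<Rightarrow> nat) \<Rightarrow> nat \<Rightarrow> nat \<Rightarrow> nat set" where
  "T'_cands i s t' = {t \<in> T_set i s. i t' < t \<and> i t \<le> s - 1}"

text \<open>\<open>T'_seq i s j\<close> is \<open>t'\<^bsub>j+1\<^esub>\<close>, and \<open>T'_length i s\<close> is \<open>r\<close>.\<close>

primrec T'_seq :: "(nat \<Rightarrow> nat) \<Rightarrow> nat \<Rightarrow> nat \<Rightarrow> nat" where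
  "T'_seq i s 0 = T_seq i s (T_last i s)"
| "T'_seq i s (Suc j) = Min (T'_cands i s (T'_seq i s j))"

definition T'_length :: "(nat \<Rightarrow> nat) \<Rightarrow> nat \<Rightarrow> nat" where
  "T'_length i s = Suc (LEAST j. T'_cands i s (T'_seq i s j) = {})"

text \<open>
  \<open>tk i s j\<close> is \<open>t\<^bsub>k\<^sub>j\<^esub>\<close>: for \<open>1 \<le> j \<le> r\<close> it is \<open>t'\<^bsub>r-j+1\<^esub>\<close>, and for \<open>j = 0\<close> it is \<open>t\<^sub>l\<close>, with \<open>l\<close>
  given by \<open>l_index i s\<close>.
\<close>

definition l_index :: "(nat \<Rightarrow> nat) \<Rightarrow> nat \<Rightarrow> nat" where
  "l_index i s = Max {l \<in> {0..T_last i s}. i (T'_seq i s (T'_length i s - 1)) + 1 \<le> T_seq i s l}"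

definition tk :: "(nat \<Rightarrow> nat) \<Rightarrow> nat \<Rightarrow> nat \<Rightarrow> nat" where
  "tk i s j = (if j = 0 then T_seq i s (l_index i s) else T'_seq i s (T'_length i s - j))"

end

theory Submission
  imports Defs
begin

text \<open>
  Write \<open>h p = i p - p + 1\<close>. A monomial lies in \<open>sfBorel(m)\<close> iff for every \<open>p\<close> its support has at
  least \<open>p\<close> elements in \<open>{1..i p}\<close>, that is, iff its support meets every \<open>A \<subseteq> {1..i p}\<close> with
  \<open>h p\<close> elements (\<open>sfBorel_eq\<close>). So the ideal is the intersection of the primes
  \<open>(x\<^sub>a : a \<in> A)\<close>, and its \<open>q\<close>-th symbolic power consists of the polynomials all of whose
  monomials have degree at least \<open>q\<close> in the variables of each such \<open>A\<close>
  (\<open>symbolic_power_squarefree\<close>). After division by \<open>q\<close>, the least degree of such a monomial becomes a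
  linear program: minimise \<open>\<Sum>x. y x\<close> over \<open>y \<ge> 0\<close> with \<open>\<Sum>x\<in>A. y x \<ge> 1\<close> for all \<open>A\<close>. Rounding
  costs at most \<open>n\<close> in total, so the Waldschmidt constant is the value of this program
  (\<open>waldschmidt_eq_linear_program\<close>).

  To solve it, read \<open>T'(m)\<close> upwards and append \<open>t\<^sub>l\<close>; this gives indices \<open>u 0 < \<dots> < u (R + 1)\<close> with
  \<open>i (u j) < u (j + 1)\<close>. Cut the indices of the variables after \<open>i (u 0)\<close>, \<dots>, \<open>i (u R)\<close> and number the blocks
  from 0.

  Upper bound. Let \<open>y\<close> be \<open>1 / h (u j)\<close> on block \<open>j\<close>, where the last block
  stops after \<open>h (u (R + 1))\<close> indices counted from \<open>s\<close>, and 0 beyond. As \<open>y\<close> is nonincreasing, the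
  worst set \<open>A\<close> for \<open>p\<close> is the interval \<open>{p..i p}\<close>. If \<open>i (p + 1) = i p + 1\<close>, the constraint for \<open>p\<close>
  follows from the one for \<open>p + 1\<close>, which leaves \<open>p \<in> T(m)\<close>. There the interval
  contains enough indices of a single block to have sum at least 1, or it lies in two consecutive blocks
  and the assumed inequality says exactly that its sum is at least 1 (\<open>optimal_weight_feasible\<close>).

  Lower bound. Block \<open>j\<close> for \<open>j \<le> R\<close> is contained in \<open>{1..i (u j)}\<close> and has at least \<open>h (u j)\<close>
  elements, so averaging the constraints for \<open>u j\<close> shows that every feasible \<open>y\<close> has average at
  least \<open>1 / h (u j)\<close> on it. On \<open>{i (u R) + 1..i s}\<close> take \<open>s - 1 - i (u R)\<close> indices up to \<open>i (u (R + 1))\<close>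
  with average at least \<open>1 / h (u (R + 1))\<close>; the remaining \<open>h s\<close> indices have sum at least 1 by the
  constraint for \<open>s\<close> (\<open>optimum_le_feasible\<close>). Adding up gives the total weight of the \<open>y\<close> above.
\<close>

section \<open>Monomial ideals\<close>

lemma poly_mapping_terms_induct:
  fixes p :: "'a \<Rightarrow>\<^sub>0 ('b::comm_monoid_add)"
  assumes "P 0" and "\<And>f g. P f \<Longrightarrow> P g \<Longrightarrow> P (f + g)"
    and "\<And>u. u \<in> Poly_Mapping.keys p \<Longrightarrow> P (Poly_Mapping.single u (Poly_Mapping.lookup p u))"
  shows "P p"
proof -
  let ?t = "\<lambda>u. Poly_Mapping.single u (Poly_Mapping.lookup p u)"
  have "P (sum ?t B)" if "finite B" "B \<subseteq> Poly_Mapping.keys p" for B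
    using that by (induction B rule: finite_induct) (auto intro!: assms)
  then have "P (sum ?t (Poly_Mapping.keys p))" by simp
  moreover have "sum ?t (Poly_Mapping.keys p) = p"
    by (rule poly_mapping_eqI)
      (simp add: lookup_sum lookup_single when_def in_keys_iff sum.delta)
  ultimately show ?thesis by simp
qed

lemma keys_add_monom:
  "Poly_Mapping.keys (u + v :: monom) = Poly_Mapping.keys u \<union> Poly_Mapping.keys v"
  by (auto simp: in_keys_iff lookup_add)

lemma keys_var [simp]: "Poly_Mapping.keys (var x) = {x}"
  by (simp add: var_def)

lemma mdeg_eq_sum:
  assumes "finite B" "Poly_Mapping.keys u \<subseteq> B"
  shows "mdeg u = (\<Sum>x\<in>B. Poly_Mapping.lookup u x)"
  unfolding mdeg_def using assms
  by (intro sum.mono_neutral_left) (auto simp: in_keys_iff)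

text \<open>
  A monomial ideal is handled through the set of its monomials rather than through generators:
  intersections, powers and least degrees can be read off from that set.
\<close>

definition monomial_ideal :: "nat \<Rightarrow> (monom \<Rightarrow> bool) \<Rightarrow> ('k::field) mpoly set" where
  "monomial_ideal n Q = {p. \<forall>u\<in>Poly_Mapping.keys p. Poly_Mapping.keys u \<subseteq> {1..n} \<and> Q u}"

lemma carrier_eq_monomial_ideal: "carrier (poly_ring n) = monomial_ideal n (\<lambda>_. True)"
  by (simp add: poly_ring_def monomial_ideal_def)

lemma poly_ring_simps [simp]:
  "zero (poly_ring n) = 0" "one (poly_ring n) = 1"
  "add (poly_ring n) = (+)" "mult (poly_ring n) = (*)"
  by (simp_all add: poly_ring_def)

lemma monomial_ideal_zero: "0 \<in> monomial_ideal n Q"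
  by (simp add: monomial_ideal_def)

lemma monomial_ideal_add:
  "f \<in> monomial_ideal n Q \<Longrightarrow> g \<in> monomial_ideal n Q \<Longrightarrow> f + g \<in> monomial_ideal n Q"
  unfolding monomial_ideal_def using keys_add[of f g] by blast

lemma monomial_ideal_uminus:
  "f \<in> monomial_ideal n Q \<Longrightarrow> - f \<in> monomial_ideal n Q"
  by (simp add: monomial_ideal_def in_keys_iff)

lemma monomial_ideal_single:
  "Poly_Mapping.keys u \<subseteq> {1..n} \<Longrightarrow> Q u \<Longrightarrow> Poly_Mapping.single u c \<in> monomial_ideal n Q"
  by (simp add: monomial_ideal_def)

text \<open>
  Three predicates, because this serves for multiplication by ring elements, for products of
  ideals, and for products of polynomials that avoid a set of variables.
\<close>

lemma monomial_ideal_mult: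
  assumes "f \<in> monomial_ideal n Q" "g \<in> monomial_ideal n Q'" "\<And>u v. Q u \<Longrightarrow> Q' v \<Longrightarrow> Q'' (u + v)"
  shows "f * g \<in> monomial_ideal n Q''"
proof -
  have "Poly_Mapping.keys w \<subseteq> {1..n} \<and> Q'' w" if w: "w \<in> Poly_Mapping.keys (f * g)" for w
  proof -
    obtain u v where uv: "w = u + v" "u \<in> Poly_Mapping.keys f" "v \<in> Poly_Mapping.keys g"
      using w keys_mult[of f g] by auto
    then show ?thesis using assms by (simp add: monomial_ideal_def keys_add_monom)
  qed
  then show ?thesis by (simp add: monomial_ideal_def)
qed

lemma poly_ring_cring: "cring (poly_ring n)"
proof (rule cringI)
  show "abelian_group (poly_ring n)"
  proof (rule abelian_groupI)
    fix x assume "x \<in> carrier (poly_ring n)"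
    then show "\<exists>y\<in>carrier (poly_ring n). y \<oplus>\<^bsub>poly_ring n\<^esub> x = \<zero>\<^bsub>poly_ring n\<^esub>"
      by (intro bexI[of _ "- x"]) (auto simp: carrier_eq_monomial_ideal monomial_ideal_uminus)
  qed (auto simp: carrier_eq_monomial_ideal monomial_ideal_zero monomial_ideal_add algebra_simps)
  show "comm_monoid (poly_ring n)"
  proof (rule comm_monoidI)
    show "\<one>\<^bsub>poly_ring n\<^esub> \<in> carrier (poly_ring n)"
      by (simp add: carrier_eq_monomial_ideal monomial_ideal_def)
  qed (auto simp: carrier_eq_monomial_ideal algebra_simps
        intro: monomial_ideal_mult[where Q = "\<lambda>_. True" and Q' = "\<lambda>_. True"])
qed (auto simp: algebra_simps)

lemma poly_ring_ring: "ring (poly_ring n)"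
  using poly_ring_cring cring.axioms(1) by blast

definition up_closed :: "(monom \<Rightarrow> bool) \<Rightarrow> bool" where
  "up_closed Q \<longleftrightarrow> (\<forall>u v. Q u \<longrightarrow> Q (u + v))"

lemma monomial_ideal_subset: "monomial_ideal n Q \<subseteq> carrier (poly_ring n)"
  by (auto simp: carrier_eq_monomial_ideal monomial_ideal_def)

lemma monomial_ideal_is_ideal:
  assumes "up_closed Q"
  shows "ideal (monomial_ideal n Q :: ('k::field) mpoly set) (poly_ring n)"
proof -
  interpret ring "poly_ring n :: 'k mpoly ring" by (rule poly_ring_ring)
  have mult: "f * g \<in> monomial_ideal n Q"
    if "f \<in> monomial_ideal n Q" "g \<in> carrier (poly_ring n)" for f g :: "'k mpoly"
    using that assms unfolding carrier_eq_monomial_ideal up_closed_def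
    by (auto intro: monomial_ideal_mult)
  show ?thesis
  proof (rule idealI[OF poly_ring_ring])
    show "subgroup (monomial_ideal n Q :: 'k mpoly set) (add_monoid (poly_ring n))"
    proof (rule add.subgroupI)
      show "(monomial_ideal n Q :: 'k mpoly set) \<noteq> {}" using monomial_ideal_zero by blast
      fix a :: "'k mpoly" assume a: "a \<in> monomial_ideal n Q"
      then have "a \<in> carrier (poly_ring n)" "- a \<in> carrier (poly_ring n)"
        using monomial_ideal_subset monomial_ideal_uminus by blast+
      then have "\<ominus>\<^bsub>poly_ring n\<^esub> a = - a"
        by (intro minus_equality) auto
      then show "\<ominus>\<^bsub>poly_ring n\<^esub> a \<in> monomial_ideal n Q"
        using monomial_ideal_uminus[OF a] by simp
    qed (auto simp: monomial_ideal_subset monomial_ideal_add)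
  next
    fix a x :: "'k mpoly" assume "a \<in> monomial_ideal n Q" "x \<in> carrier (poly_ring n)"
    then show "a \<otimes>\<^bsub>poly_ring n\<^esub> x \<in> monomial_ideal n Q" using mult by simp
  next
    fix a x :: "'k mpoly" assume "a \<in> monomial_ideal n Q" "x \<in> carrier (poly_ring n)"
    then show "x \<otimes>\<^bsub>poly_ring n\<^esub> a \<in> monomial_ideal n Q"
      using mult by (simp add: mult.commute)
  qed
qed

text \<open>
  Each term of a polynomial on the right is a ring multiple of a generator, and an ideal contains
  the sum of the terms.
\<close>

lemma genideal_monomials:
  assumes gens: "\<And>g. g \<in> G \<Longrightarrow> Poly_Mapping.keys g \<subseteq> {1..n}"
    and div: "\<And>u. Poly_Mapping.keys u \<subseteq> {1..n} \<Longrightarrow> Q u \<longleftrightarrow> (\<exists>g\<in>G. \<exists>v. u = g + v)"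
    and up: "up_closed Q"
  shows "genideal (poly_ring n) ((\<lambda>g. Poly_Mapping.single g (1::'k::field)) ` G)
    = (monomial_ideal n Q :: 'k mpoly set)"
proof -
  interpret ring "poly_ring n :: 'k mpoly ring" by (rule poly_ring_ring)
  let ?S = "(\<lambda>g. Poly_Mapping.single g (1::'k)) ` G"
  have S: "?S \<subseteq> monomial_ideal n Q"
    using gens div by (force intro!: monomial_ideal_single intro: exI[of _ "0::monom"])
  then have Sc: "?S \<subseteq> carrier (poly_ring n)"
    using monomial_ideal_subset by blast
  interpret J: ideal "genideal (poly_ring n) ?S" "poly_ring n :: 'k mpoly ring"
    by (rule genideal_ideal[OF Sc])
  show ?thesis
  proof
    show "genideal (poly_ring n) ?S \<subseteq> monomial_ideal n Q"
      by (rule genideal_minimal[OF monomial_ideal_is_ideal[OF up] S])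
    show "monomial_ideal n Q \<subseteq> genideal (poly_ring n) ?S"
    proof
      fix p :: "'k mpoly" assume p: "p \<in> monomial_ideal n Q"
      show "p \<in> genideal (poly_ring n) ?S"
      proof (rule poly_mapping_terms_induct)
        show "0 \<in> genideal (poly_ring n) ?S" using J.zero_closed by simp
        show "f + g \<in> genideal (poly_ring n) ?S"
          if "f \<in> genideal (poly_ring n) ?S" "g \<in> genideal (poly_ring n) ?S" for f g
          using J.a_closed that by simp
        fix u assume u: "u \<in> Poly_Mapping.keys p"
        let ?c = "Poly_Mapping.lookup p u"
        have ku: "Poly_Mapping.keys u \<subseteq> {1..n}" and Qu: "Q u"
          using p u by (auto simp: monomial_ideal_def)
        obtain g v where g: "g \<in> G" "u = g + v" using div[OF ku] Qu by blast
        have "Poly_Mapping.keys v \<subseteq> {1..n}" using ku g by (simp add: keys_add_monom)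
        then have "Poly_Mapping.single v ?c \<in> carrier (poly_ring n)"
          by (simp add: carrier_eq_monomial_ideal monomial_ideal_single)
        moreover have "Poly_Mapping.single g 1 \<in> genideal (poly_ring n) ?S"
          using genideal_self[OF Sc] g by blast
        ultimately have "Poly_Mapping.single v ?c \<otimes>\<^bsub>poly_ring n\<^esub> Poly_Mapping.single g 1
            \<in> genideal (poly_ring n) ?S"
          by (rule J.I_l_closed[rotated])
        then show "Poly_Mapping.single u ?c \<in> genideal (poly_ring n) ?S"
          by (simp add: mult_single g add.commute)
      qed
    qed
  qed
qed

text \<open>
  Every generator is nonzero, so it has a monomial, which lies in the ideal and has the degree of the
  generator. Conversely, all monomials of the ideal together are an admissible generating set, so the
  degree of any of them occurs as a degree of a generator.
\<close>

lemma alpha_monomial_ideal: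
  assumes up: "up_closed Q"
  shows "alpha n (monomial_ideal n Q :: ('k::field) mpoly set)
    = (LEAST d. \<exists>u::monom. Poly_Mapping.keys u \<subseteq> {1..n} \<and> Q u \<and> mdeg u = d)"
proof -
  interpret ring "poly_ring n :: 'k mpoly ring" by (rule poly_ring_ring)
  let ?J = "monomial_ideal n Q :: 'k mpoly set"
  let ?G = "{u::monom. Poly_Mapping.keys u \<subseteq> {1..n} \<and> Q u}"
  have gen: "genideal (poly_ring n) ((\<lambda>g. Poly_Mapping.single g (1::'k)) ` ?G) = ?J"
  proof (rule genideal_monomials[OF _ _ up])
    fix u :: monom assume "Poly_Mapping.keys u \<subseteq> {1..n}"
    then show "Q u \<longleftrightarrow> (\<exists>g\<in>?G. \<exists>v. u = g + v)"
      using up by (auto simp: up_closed_def intro: exI[of _ "0::monom"] exI[of _ "u::monom"])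
  qed auto
  have "(\<exists>G. G \<subseteq> carrier (poly_ring n) - {0} \<and> (\<forall>g\<in>G. \<exists>e. homogeneous e g) \<and>
          ?J = genideal (poly_ring n) G \<and> (\<exists>g\<in>G. homogeneous d g))
      \<longleftrightarrow> (\<exists>u::monom. Poly_Mapping.keys u \<subseteq> {1..n} \<and> Q u \<and> mdeg u = d)" (is "?A \<longleftrightarrow> ?B") for d
  proof
    assume ?A
    then obtain G g where G: "G \<subseteq> carrier (poly_ring n) - {0}" "?J = genideal (poly_ring n) G"
      and g: "g \<in> G" "homogeneous d g" by blast
    have "g \<in> ?J" unfolding G(2) using genideal_self[of G] G(1) g by blast
    moreover have "Poly_Mapping.keys g \<noteq> {}" using G(1) g(1) by auto
    then obtain u where "u \<in> Poly_Mapping.keys g" by blast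
    ultimately show ?B using g(2) by (auto simp: monomial_ideal_def homogeneous_def)
  next
    assume ?B
    then obtain u where u: "u \<in> ?G" "mdeg u = d" by blast
    show ?A
    proof (intro exI[of _ "(\<lambda>g. Poly_Mapping.single g (1::'k)) ` ?G"] conjI)
      show "\<forall>g\<in>(\<lambda>g. Poly_Mapping.single g (1::'k)) ` ?G. \<exists>e. homogeneous e g"
        by (simp add: homogeneous_def)
      show "(\<lambda>g. Poly_Mapping.single g (1::'k)) ` ?G \<subseteq> carrier (poly_ring n) - {0}"
        by (auto simp: carrier_eq_monomial_ideal monomial_ideal_def simp flip: keys_eq_empty)
      show "\<exists>g\<in>(\<lambda>g. Poly_Mapping.single g (1::'k)) ` ?G. homogeneous d g"
        using u by (intro bexI[of _ "Poly_Mapping.single u 1"]) (auto simp: homogeneous_def)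
    qed (rule gen[symmetric])
  qed
  then show ?thesis unfolding alpha_def by simp
qed

section \<open>Symbolic powers of square-free monomial ideals\<close>

definition weight :: "nat set \<Rightarrow> monom \<Rightarrow> nat" where
  "weight A u = (\<Sum>a\<in>A. Poly_Mapping.lookup u a)"

lemma weight_add: "weight A (u + v) = weight A u + weight A v"
  by (simp add: weight_def lookup_add sum.distrib)

lemma weight_var: "finite A \<Longrightarrow> weight A (var a) = (if a \<in> A then 1 else 0)"
  by (simp add: weight_def var_def lookup_single when_def)

lemma weight_pos_iff:
  "finite A \<Longrightarrow> 1 \<le> weight A u \<longleftrightarrow> A \<inter> Poly_Mapping.keys u \<noteq> {}"
  by (auto simp: weight_def in_keys_iff Suc_le_eq sum_eq_0_iff neq0_conv[symmetric] simp del: neq0_conv)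

text \<open>
  The \<open>q\<close>-th power of the ideal \<open>(x\<^sub>a : a \<in> A)\<close>, see \<open>var_ideal_pow\<close> below.
\<close>

definition var_ideal_power :: "nat \<Rightarrow> nat set \<Rightarrow> nat \<Rightarrow> ('k::field) mpoly set" where
  "var_ideal_power n A q = monomial_ideal n (\<lambda>u. q \<le> weight A u)"

lemma up_closed_weight: "up_closed (\<lambda>u. q \<le> weight A u)"
  by (auto simp: up_closed_def weight_add)

lemma var_ideal_power_0: "var_ideal_power n A 0 = carrier (poly_ring n)"
  by (simp add: var_ideal_power_def carrier_eq_monomial_ideal)

text \<open>
  A monomial of degree at least \<open>q + 1\<close> in the variables of \<open>A\<close> is a variable of \<open>A\<close> times a monomial of
  degree at least \<open>q\<close> in them.
\<close>

lemma var_ideal_power_Suc: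
  assumes "finite A"
  shows "ideal_prod (poly_ring n) (var_ideal_power n A q) (var_ideal_power n A 1)
    = (var_ideal_power n A (Suc q) :: ('k::field) mpoly set)"
    (is "?L = ?R")
proof
  show "?L \<subseteq> ?R"
  proof
    fix p assume "p \<in> ?L"
    then show "p \<in> ?R"
    proof (induction rule: ideal_prod.induct)
      case (prod f g)
      then show ?case
        unfolding var_ideal_power_def
        by (auto intro!: monomial_ideal_mult[of f n _ g] simp: weight_add)
    next
      case (sum f g)
      then show ?case unfolding var_ideal_power_def by (simp add: monomial_ideal_add)
    qed
  qed
  show "?R \<subseteq> ?L"
  proof
    fix p :: "'k mpoly" assume p: "p \<in> ?R"
    show "p \<in> ?L"
    proof (rule poly_mapping_terms_induct)
      show "0 \<in> ?L"
        using ideal_prod.prod[of 0 "var_ideal_power n A q" 0 "var_ideal_power n A 1" "poly_ring n"]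
        by (simp add: var_ideal_power_def monomial_ideal_zero)
      show "f + g \<in> ?L" if "f \<in> ?L" "g \<in> ?L" for f g
        using ideal_prod.sum[OF that] by simp
      fix u assume u: "u \<in> Poly_Mapping.keys p"
      let ?c = "Poly_Mapping.lookup p u"
      have ku: "Poly_Mapping.keys u \<subseteq> {1..n}" and wu: "Suc q \<le> weight A u"
        using p u by (auto simp: monomial_ideal_def var_ideal_power_def)
      then have "1 \<le> weight A u" by simp
      then obtain a where a: "a \<in> A" "a \<in> Poly_Mapping.keys u"
        using weight_pos_iff[OF assms] by blast
      define v where "v = u - var a"
      have uv: "u = v + var a"
        by (rule poly_mapping_eqI)
          (use a in \<open>auto simp: v_def lookup_add lookup_minus var_def lookup_single when_def in_keys_iff\<close>)
      have "Poly_Mapping.single v ?c \<in> var_ideal_power n A q"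
        unfolding var_ideal_power_def
      proof (rule monomial_ideal_single)
        show "Poly_Mapping.keys v \<subseteq> {1..n}" using ku uv by (simp add: keys_add_monom)
        show "q \<le> weight A v" using wu a assms by (simp add: uv weight_add weight_var)
      qed
      moreover have "Poly_Mapping.single (var a) 1 \<in> var_ideal_power n A 1"
        unfolding var_ideal_power_def
        using a ku assms by (intro monomial_ideal_single) (auto simp: weight_var)
      ultimately have "Poly_Mapping.single v ?c \<otimes>\<^bsub>poly_ring n\<^esub> Poly_Mapping.single (var a) 1 \<in> ?L"
        by (rule ideal_prod.prod)
      then show "Poly_Mapping.single u ?c \<in> ?L" by (simp add: mult_single uv)
    qed
  qed
qed

lemma var_ideal_pow:
  assumes "finite A"
  shows "var_ideal_power n A 1 [^]\<^bsub>ideals_set (poly_ring n)\<^esub> q = (var_ideal_power n A q :: ('k::field) mpoly set)"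
proof (induction q)
  case 0
  then show ?case by (simp add: nat_pow_def ideals_set_def var_ideal_power_0)
next
  case (Suc q)
  have "(var_ideal_power n A 1 :: 'k mpoly set) [^]\<^bsub>ideals_set (poly_ring n)\<^esub> Suc q
      = ideal_prod (poly_ring n)
          (var_ideal_power n A 1 [^]\<^bsub>ideals_set (poly_ring n)\<^esub> q) (var_ideal_power n A 1)"
    by (simp add: nat_pow_def ideals_set_def)
  then show ?case by (simp only: Suc.IH var_ideal_power_Suc[OF assms])
qed

lemma split_poly_by_monomials:
  fixes f :: "('k::field) mpoly"
  obtains f0 f1 where "f = f0 + f1" "Poly_Mapping.keys f0 \<subseteq> {u \<in> Poly_Mapping.keys f. \<not> Q u}"
    "Poly_Mapping.keys f1 \<subseteq> {u \<in> Poly_Mapping.keys f. Q u}"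
proof -
  define f1 where "f1 = (\<Sum>u | u \<in> Poly_Mapping.keys f \<and> Q u. Poly_Mapping.single u (Poly_Mapping.lookup f u))"
  have l: "Poly_Mapping.lookup f1 u = (if Q u then Poly_Mapping.lookup f u else 0)" for u
    by (auto simp: f1_def lookup_sum lookup_single when_def in_keys_iff sum.delta)
  show thesis
    by (rule that[of "f - f1" f1]) (auto simp: in_keys_iff lookup_minus l split: if_splits)
qed

text \<open>
  Drop from both factors all monomials that involve a variable of \<open>A\<close>. The product of what remains
  lies in the ideal but involves no variable of \<open>A\<close>, so it vanishes; since polynomials have no zero
  divisors, one factor had nothing outside the ideal.
\<close>

lemma primeideal_var_ideal:
  assumes A: "A \<subseteq> {1..n}"
  shows "primeideal (var_ideal_power n A 1 :: ('k::field) mpoly set) (poly_ring n)"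
proof (rule primeidealI)
  have fin: "finite A" using A finite_subset by blast
  show id: "ideal (var_ideal_power n A 1) (poly_ring n :: 'k mpoly ring)"
    unfolding var_ideal_power_def by (rule monomial_ideal_is_ideal[OF up_closed_weight])
  interpret P: ideal "var_ideal_power n A 1" "poly_ring n :: 'k mpoly ring" by (rule id)
  show "cring (poly_ring n :: 'k mpoly ring)" by (rule poly_ring_cring)
  have "(1 :: 'k mpoly) \<notin> var_ideal_power n A 1"
    by (simp add: var_ideal_power_def monomial_ideal_def weight_def)
  moreover have "(1 :: 'k mpoly) \<in> carrier (poly_ring n)"
    by (simp add: carrier_eq_monomial_ideal monomial_ideal_def)
  ultimately show "carrier (poly_ring n :: 'k mpoly ring) \<noteq> var_ideal_power n A 1" by metis
  fix f g :: "'k mpoly"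
  assume fg: "f \<in> carrier (poly_ring n)" "g \<in> carrier (poly_ring n)"
    "f \<otimes>\<^bsub>poly_ring n\<^esub> g \<in> var_ideal_power n A 1"
  let ?Q = "\<lambda>u. 1 \<le> weight A u"
  obtain f0 f1 where f: "f = f0 + f1" "Poly_Mapping.keys f0 \<subseteq> {u \<in> Poly_Mapping.keys f. \<not> ?Q u}"
    "Poly_Mapping.keys f1 \<subseteq> {u \<in> Poly_Mapping.keys f. ?Q u}"
    by (rule split_poly_by_monomials)
  obtain g0 g1 where g: "g = g0 + g1" "Poly_Mapping.keys g0 \<subseteq> {u \<in> Poly_Mapping.keys g. \<not> ?Q u}"
    "Poly_Mapping.keys g1 \<subseteq> {u \<in> Poly_Mapping.keys g. ?Q u}"
    by (rule split_poly_by_monomials)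
  have in1: "f1 \<in> var_ideal_power n A 1" "g1 \<in> var_ideal_power n A 1"
    using f g fg by (auto simp: var_ideal_power_def monomial_ideal_def carrier_eq_monomial_ideal)
  have in0: "f0 \<in> monomial_ideal n (\<lambda>u. \<not> ?Q u)" "g0 \<in> monomial_ideal n (\<lambda>u. \<not> ?Q u)"
    using f g fg by (auto simp: monomial_ideal_def carrier_eq_monomial_ideal)
  then have c0: "f0 \<in> carrier (poly_ring n)"
    using monomial_ideal_subset by blast
  have "f0 * g1 \<in> var_ideal_power n A 1" "f1 * g \<in> var_ideal_power n A 1"
    using P.I_l_closed[OF in1(2) c0] P.I_r_closed[OF in1(1) fg(2)] by simp_all
  then have "f * g + - (f0 * g1 + f1 * g) \<in> var_ideal_power n A 1"
    using fg(3) unfolding var_ideal_power_def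
    by (intro monomial_ideal_add monomial_ideal_uminus) auto
  also have "f * g + - (f0 * g1 + f1 * g) = f0 * g0" by (simp add: f g algebra_simps)
  finally have "f0 * g0 \<in> var_ideal_power n A 1" .
  moreover have "f0 * g0 \<in> monomial_ideal n (\<lambda>u. \<not> ?Q u)"
    using in0 by (rule monomial_ideal_mult) (simp add: weight_add)
  ultimately have "Poly_Mapping.keys (f0 * g0) = {}"
    unfolding var_ideal_power_def monomial_ideal_def by blast
  then have "f0 = 0 \<or> g0 = 0" by simp
  then show "f \<in> var_ideal_power n A 1 \<or> g \<in> var_ideal_power n A 1"
    using in1 f g by auto
qed

text \<open>
  Irredundancy uses the product of the variables outside \<open>A\<close>: no other member of \<open>F\<close> is contained
  in \<open>A\<close>, so each of them contains one of these variables.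
\<close>

lemma min_prime_decomp_antichain:
  assumes F: "\<And>A. A \<in> F \<Longrightarrow> A \<subseteq> {1..n}"
    and anti: "\<And>A B. A \<in> F \<Longrightarrow> B \<in> F \<Longrightarrow> A \<subseteq> B \<Longrightarrow> A = B"
  shows "min_prime_decomp (poly_ring n)
    (monomial_ideal n (\<lambda>u. \<forall>A\<in>F. 1 \<le> weight A u) :: ('k::field) mpoly set)
    ((\<lambda>A. var_ideal_power n A 1) ` F)"
proof -
  have "F \<subseteq> Pow {1..n}" using F by blast
  then have finF: "finite F" by (rule finite_subset) simp
  have finA: "finite A" if "A \<in> F" for A using F[OF that] finite_subset by blast
  let ?P = "\<lambda>A. var_ideal_power n A 1 :: 'k mpoly set"
  let ?L = "monomial_ideal n (\<lambda>u. \<forall>A\<in>F. 1 \<le> weight A u) :: 'k mpoly set"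
  have L: "?L = carrier (poly_ring n) \<inter> \<Inter>(?P ` F)"
    by (auto simp: carrier_eq_monomial_ideal var_ideal_power_def monomial_ideal_def)
  have irredundant: "?L \<noteq> carrier (poly_ring n) \<inter> \<Inter>(?P ` F - {?P A})" if A: "A \<in> F" for A
  proof -
    \<comment> \<open>This monomial lies in every component except the one of \<open>A\<close>.\<close>
    define u where "u = (\<Sum>x\<in>{1..n} - A. var x)"
    have lu: "Poly_Mapping.lookup u x = (if x \<in> {1..n} - A then 1 else 0)" for x
      by (auto simp: u_def lookup_sum var_def lookup_single when_def sum.delta)
    have ku: "Poly_Mapping.keys u = {1..n} - A" by (auto simp: in_keys_iff lu split: if_splits)
    have "1 \<le> weight B u" if "B \<in> F" "B \<noteq> A" for B
    proof -
      have "\<not> B \<subseteq> A" using anti[OF that(1) A] that(2) by blast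
      then have "B \<inter> Poly_Mapping.keys u \<noteq> {}" unfolding ku using F[OF that(1)] by blast
      then show ?thesis using weight_pos_iff[OF finA[OF that(1)]] by blast
    qed
    moreover have mem: "Poly_Mapping.single u (1::'k) \<in> ?P B \<longleftrightarrow> 1 \<le> weight B u" for B
      using ku by (simp add: var_ideal_power_def monomial_ideal_def)
    moreover have "Poly_Mapping.single u (1::'k) \<in> carrier (poly_ring n)"
      using ku by (simp add: carrier_eq_monomial_ideal monomial_ideal_def)
    ultimately have "Poly_Mapping.single u (1::'k) \<in> carrier (poly_ring n) \<inter> \<Inter>(?P ` F - {?P A})"
      by blast
    moreover have "A \<inter> Poly_Mapping.keys u = {}" unfolding ku by blast
    then have "\<not> 1 \<le> weight A u" using weight_pos_iff[OF finA[OF A]] by blast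
    then have "Poly_Mapping.single u (1::'k) \<notin> ?L"
      unfolding L using mem[of A] A by blast
    ultimately show ?thesis by blast
  qed
  show ?thesis
    unfolding min_prime_decomp_def
  proof (intro conjI ballI)
    show "finite (?P ` F)" using finF by simp
    show "primeideal P (poly_ring n)" if "P \<in> ?P ` F" for P
      using that F primeideal_var_ideal by blast
    show "?L \<noteq> carrier (poly_ring n) \<inter> \<Inter>(?P ` F - {P})" if "P \<in> ?P ` F" for P
      using that irredundant by blast
  qed (rule L)
qed

text \<open>
  The minimal primes belong to the inclusion-minimal members of \<open>F\<close>. Passing to these changes neither
  side, because the weight of a monomial is monotone in the set of variables.
\<close>

lemma symbolic_power_squarefree:
  assumes F: "\<And>A. A \<in> F \<Longrightarrow> A \<subseteq> {1..n}"
  shows "symbolic_power (poly_ring n)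
      (monomial_ideal n (\<lambda>u. \<forall>A\<in>F. 1 \<le> weight A u) :: ('k::field) mpoly set) q
    = monomial_ideal n (\<lambda>u. \<forall>A\<in>F. q \<le> weight A u)"
proof -
  have "F \<subseteq> Pow {1..n}" using F by blast
  then have finF: "finite F" by (rule finite_subset) simp
  define M where "M = {A\<in>F. \<forall>B\<in>F. B \<subseteq> A \<longrightarrow> B = A}"
  have M: "\<exists>B\<in>M. B \<subseteq> A" if A: "A \<in> F" for A
    using finite_has_minimal2[OF finF A] by (auto simp: M_def)
  have mono: "weight B u \<le> weight A u" if "B \<subseteq> A" "A \<in> F" for A B u
    unfolding weight_def using that F[of A] by (intro sum_mono2) (auto intro: finite_subset)
  have eq: "(\<forall>A\<in>F. q \<le> weight A u) \<longleftrightarrow> (\<forall>A\<in>M. q \<le> weight A u)" for q u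
  proof
    assume *: "\<forall>A\<in>M. q \<le> weight A u"
    show "\<forall>A\<in>F. q \<le> weight A u"
    proof
      fix A assume A: "A \<in> F"
      obtain B where "B \<in> M" "B \<subseteq> A" using M[OF A] by blast
      then show "q \<le> weight A u" using * mono[OF _ A] le_trans by blast
    qed
  qed (auto simp: M_def)
  have "min_prime_decomp (poly_ring n)
      (monomial_ideal n (\<lambda>u. \<forall>A\<in>M. 1 \<le> weight A u) :: 'k mpoly set)
      ((\<lambda>A. var_ideal_power n A 1) ` M)"
  proof (rule min_prime_decomp_antichain)
    show "A \<subseteq> {1..n}" if "A \<in> M" for A using that F by (simp add: M_def)
    show "A = B" if "A \<in> M" "B \<in> M" "A \<subseteq> B" for A B using that by (simp add: M_def)
  qed
  then have "(THE Ps. min_prime_decomp (poly_ring n)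
      (monomial_ideal n (\<lambda>u. \<forall>A\<in>F. 1 \<le> weight A u) :: 'k mpoly set) Ps)
      = (\<lambda>A. var_ideal_power n A 1) ` M"
    unfolding eq by (intro the_equality) (assumption, rule min_prime_decomp_unique)
  moreover have "var_ideal_power n A 1 [^]\<^bsub>ideals_set (poly_ring n)\<^esub> q
      = (var_ideal_power n A q :: 'k mpoly set)" if "A \<in> M" for A
    using that F by (intro var_ideal_pow) (auto simp: M_def intro: finite_subset)
  ultimately show ?thesis
    unfolding symbolic_power_def eq
    by (auto simp: carrier_eq_monomial_ideal var_ideal_power_def monomial_ideal_def)
qed

section \<open>The Waldschmidt constant as the value of a linear program\<close>

lemma lookup_sum_single:
  assumes "finite B"
  shows "Poly_Mapping.lookup (\<Sum>x\<in>B. Poly_Mapping.single x (h x)) x = (if x \<in> B then h x else 0)"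
  using assms by (auto simp: lookup_sum lookup_single when_def sum.delta)

text \<open>
  The least degree in the \<open>q\<close>-th symbolic power lies between \<open>V * q\<close> and \<open>V * q + n\<close>: it is the
  value of an integer program whose linear relaxation has value \<open>V * q\<close>.
\<close>

theorem waldschmidt_eq_linear_program:
  fixes V :: real and y :: "nat \<Rightarrow> real"
  assumes F: "\<And>A. A \<in> F \<Longrightarrow> A \<subseteq> {1..n}"
    and y: "\<And>x. 0 \<le> y x" "\<And>A. A \<in> F \<Longrightarrow> 1 \<le> sum y A" "sum y {1..n} \<le> V"
    and opt: "\<And>z :: nat \<Rightarrow> real. (\<And>x. 0 \<le> z x) \<Longrightarrow> (\<And>A. A \<in> F \<Longrightarrow> 1 \<le> sum z A) \<Longrightarrow> V \<le> sum z {1..n}"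
  shows "alpha_ratio n (monomial_ideal n (\<lambda>u. \<forall>A\<in>F. 1 \<le> weight A u) :: ('k::field) mpoly set)
    \<longlonglongrightarrow> V"
proof -
  let ?L = "monomial_ideal n (\<lambda>u. \<forall>A\<in>F. 1 \<le> weight A u) :: 'k mpoly set"
  define feas where "feas q u \<longleftrightarrow> Poly_Mapping.keys u \<subseteq> {1..n} \<and> (\<forall>A\<in>F. q \<le> weight A u)"
    for q and u :: monom
  define a where "a q = alpha n (symbolic_power (poly_ring n) ?L q)" for q
  have a: "a q = (LEAST d. \<exists>u. feas q u \<and> mdeg u = d)" for q
  proof -
    have "up_closed (\<lambda>u. \<forall>A\<in>F. q \<le> weight A u)"
      by (auto simp: up_closed_def weight_add intro: trans_le_add1)
    moreover have "symbolic_power (poly_ring n) ?L q = monomial_ideal n (\<lambda>u. \<forall>A\<in>F. q \<le> weight A u)"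
      using F by (rule symbolic_power_squarefree)
    ultimately show ?thesis by (simp add: a_def feas_def alpha_monomial_ideal conj_assoc)
  qed
  have bounds: "V * q \<le> a q \<and> a q \<le> V * q + n" if q: "0 < q" for q
  proof -
    \<comment> \<open>Rounding \<open>q \<cdot> y\<close> up keeps feasibility and costs less than 1 in each variable.\<close>
    define u0 where "u0 = (\<Sum>x\<in>{1..n}. Poly_Mapping.single x (nat \<lceil>q * y x\<rceil>))"
    have u0: "Poly_Mapping.lookup u0 x = (if x \<in> {1..n} then nat \<lceil>q * y x\<rceil> else 0)" for x
      unfolding u0_def by (rule lookup_sum_single) simp
    have k0: "Poly_Mapping.keys u0 \<subseteq> {1..n}" by (auto simp: in_keys_iff u0 split: if_splits)
    have feas0: "feas q u0"
    proof -
      have "q \<le> weight A u0" if A: "A \<in> F" for A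
      proof -
        have "real q \<le> q * sum y A" using y(2)[OF A] q by simp
        also have "\<dots> = (\<Sum>x\<in>A. q * y x)" by (simp add: sum_distrib_left)
        also have "\<dots> \<le> (\<Sum>x\<in>A. real (Poly_Mapping.lookup u0 x))"
          using F[OF A] y(1) by (intro sum_mono) (auto simp: u0 subset_iff real_nat_ceiling_ge)
        also have "\<dots> = real (weight A u0)" by (simp add: weight_def)
        finally show ?thesis by simp
      qed
      then show ?thesis using k0 by (simp add: feas_def)
    qed
    have "mdeg u0 = (\<Sum>x\<in>{1..n}. nat \<lceil>q * y x\<rceil>)"
      using mdeg_eq_sum[OF _ k0] by (simp add: u0)
    also have "real \<dots> \<le> (\<Sum>x\<in>{1..n}. q * y x + 1)"
      unfolding of_nat_sum using y(1)
      by (intro sum_mono) (simp add: of_nat_nat ceiling_correct less_imp_le)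
    also have "\<dots> = q * sum y {1..n} + n" by (simp add: sum.distrib sum_distrib_left)
    also have "\<dots> \<le> V * q + n" using y(3) q by (simp add: mult.commute)
    finally have u0_le: "real (mdeg u0) \<le> V * q + n" .
    have "a q \<le> mdeg u0" unfolding a using feas0 by (intro Least_le) blast
    then have up: "a q \<le> V * q + n" using u0_le by linarith
    have "\<exists>u. feas q u \<and> mdeg u = a q" unfolding a by (rule LeastI_ex) (use feas0 in blast)
    then obtain u where u: "feas q u" "mdeg u = a q" by blast
    \<comment> \<open>Scaling a monomial of least degree down gives a feasible point.\<close>
    define z where "z x = Poly_Mapping.lookup u x / real q" for x
    have sum_z: "sum z A = weight A u / real q" for A
      by (simp add: z_def weight_def flip: sum_divide_distrib)
    have "V \<le> sum z {1..n}"
    proof (rule opt)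
      show "1 \<le> sum z A" if "A \<in> F" for A
        using u(1) that q by (simp add: sum_z feas_def)
    qed (simp add: z_def)
    also have "weight {1..n} u = a q"
      using mdeg_eq_sum[of "{1..n}" u] u by (simp add: weight_def feas_def)
    then have "sum z {1..n} = a q / q" by (simp add: sum_z)
    finally show ?thesis using up q by (simp add: field_simps)
  qed
  have "(\<lambda>q. real (a q) / real q) \<longlonglongrightarrow> V"
  proof (rule tendsto_sandwich)
    show "\<forall>\<^sub>F q in sequentially. V \<le> real (a q) / real q"
      using eventually_gt_at_top[of 0] by eventually_elim (use bounds in \<open>simp add: field_simps\<close>)
    show "\<forall>\<^sub>F q in sequentially. real (a q) / real q \<le> V + real n / real q"
      using eventually_gt_at_top[of 0] by eventually_elim (use bounds in \<open>simp add: field_simps\<close>)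
    show "(\<lambda>q. V + real n / real q) \<longlonglongrightarrow> V"
      using tendsto_add[OF tendsto_const lim_const_over_n[of "real n"], of V] by simp
  qed simp
  moreover have "(\<lambda>q. real (a q) / real q) = alpha_ratio n ?L"
    by (simp add: fun_eq_iff alpha_ratio_def a_def)
  ultimately show ?thesis by simp
qed

section \<open>Averaging and block functions\<close>

text \<open>
  Averaging over subsets of size \<open>c\<close>, by removing a largest element: the rest has average at
  least \<open>a\<close> by induction, so the removed element is at least \<open>a\<close> as well.
\<close>

lemma sum_ge_of_subsets:
  fixes f :: "'a \<Rightarrow> real" and a :: real
  assumes "finite B" "1 \<le> c" "c \<le> card B"
    and "\<And>C. C \<subseteq> B \<Longrightarrow> card C = c \<Longrightarrow> c * a \<le> sum f C"
  shows "card B * a \<le> sum f B"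
  using assms(1,3,4)
proof (induction "card B" arbitrary: B rule: less_induct)
  case less
  show ?case
  proof (cases "card B = c")
    case True
    then show ?thesis using less.prems(3)[of B] by simp
  next
    case False
    have ne: "B \<noteq> {}" using less.prems(2) assms(2) by auto
    have "Max (f ` B) \<in> f ` B" using ne less.prems(1) by (intro Max_in) auto
    then obtain x where x: "x \<in> B" "f x = Max (f ` B)" by auto
    have max: "f y \<le> f x" if "y \<in> B" for y
      unfolding x(2) using that less.prems(1) by (intro Max_ge) auto
    define B' where "B' = B - {x}"
    have cB': "card B = Suc (card B')" using x less.prems(1) unfolding B'_def by (intro card.remove)
    have IH: "card B' * a \<le> sum f B'"
    proof (rule less.hyps)
      show "card B' < card B" "c \<le> card B'" using cB' False less.prems(2) by simp_all
      show "finite B'" using less.prems(1) by (simp add: B'_def)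
      show "c * a \<le> sum f C" if "C \<subseteq> B'" "card C = c" for C
        using that by (intro less.prems(3)) (auto simp: B'_def)
    qed
    also have sum_le: "sum f B' \<le> card B' * f x"
      using max by (intro sum_bounded_above) (simp add: B'_def)
    finally have le: "card B' * a \<le> card B' * f x" .
    have "0 < card B'" using cB' False less.prems(2) assms(2) by linarith
    then have "a \<le> f x" using le by simp
    moreover have "sum f B = f x + sum f B'"
      unfolding B'_def using less.prems(1) x(1) by (rule sum.remove)
    moreover have "card B * a = a + card B' * a" by (simp add: cB' algebra_simps)
    ultimately show ?thesis using IH by linarith
  qed
qed

text \<open>
  Some \<open>c\<close>-subset is at least as large as the average; otherwise \<open>sum_ge_of_subsets\<close>
  for \<open>- f\<close> would bound the whole sum.
\<close>

lemma exists_subset_sum_ge_average: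
  fixes f :: "'a \<Rightarrow> real" and a :: real
  assumes "finite B" "c \<le> card B" "card B * a \<le> sum f B"
  shows "\<exists>C\<subseteq>B. card C = c \<and> c * a \<le> sum f C"
proof (cases "c = 0")
  case True
  then show ?thesis by (intro exI[of _ "{}"]) simp
next
  case False
  show ?thesis
  proof (rule ccontr)
    assume "\<not> ?thesis"
    then have neg: "sum f C < c * a" if "C \<subseteq> B" "card C = c" for C using that by auto
    obtain C where C: "C \<subseteq> B" "card C = c" using obtain_subset_with_card_n[OF assms(2)] by blast
    \<comment> \<open>The largest sum over a \<open>c\<close>-subset turns the strict inequalities into one bound \<open>c * b\<close> with \<open>b < a\<close>.\<close>
    define S where "S = sum f ` {C. C \<subseteq> B \<and> card C = c}"
    have S: "finite S" "S \<noteq> {}" using assms(1) C by (auto simp: S_def)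
    have "Max S \<in> S" using S by (rule Max_in)
    then have lt: "Max S < c * a" using neg by (auto simp: S_def)
    define b where "b = Max S / c"
    have b: "c * b = Max S" "b < a" using False lt by (auto simp: b_def field_simps)
    have "card B * (- b) \<le> (\<Sum>x\<in>B. - f x)"
    proof (rule sum_ge_of_subsets[OF assms(1) _ assms(2)])
      fix D assume "D \<subseteq> B" "card D = c"
      then have "sum f D \<le> Max S" using S(1) by (intro Max_ge) (auto simp: S_def)
      then show "c * (- b) \<le> (\<Sum>x\<in>D. - f x)" using b by (simp add: sum_negf)
    qed (use False in simp)
    then have "sum f B \<le> card B * b" by (simp add: sum_negf)
    moreover have "card B * b < card B * a" using b False assms(2) by (intro mult_strict_left_mono) auto
    ultimately show False using assms(3) by linarith
  qed
qed

text \<open>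
  Exchange argument: the elements of \<open>A\<close> outside the final segment precede \<open>p\<close>, those of the segment
  outside \<open>A\<close> do not, and there are equally many of both.
\<close>

lemma sum_ge_final_segment:
  fixes y :: "nat \<Rightarrow> real"
  assumes mono: "\<And>a b. 1 \<le> a \<Longrightarrow> a \<le> b \<Longrightarrow> y b \<le> y a"
    and A: "A \<subseteq> {1..N}" "card A + p = N + 1" and p: "1 \<le> p"
  shows "sum y {p..N} \<le> sum y A"
proof -
  let ?B = "{p..N}"
  have fin: "finite A" using A finite_subset by blast
  have card: "card A = card ?B" using A(2) by simp
  have "card (?B - A) = card (A - ?B)"
    using card card_Diff_subset_Int[of ?B A] card_Diff_subset_Int[of A ?B] fin by (simp add: Int_commute)
  have "sum y (?B - A) \<le> card (?B - A) * y p"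
    using mono p by (intro sum_bounded_above) auto
  also have "\<dots> = card (A - ?B) * y p" using \<open>card (?B - A) = card (A - ?B)\<close> by simp
  also have "\<dots> \<le> sum y (A - ?B)"
    using mono p A by (intro sum_bounded_below) (auto simp: subset_iff)
  finally have "sum y (?B - A) \<le> sum y (A - ?B)" .
  moreover have "sum y ?B = sum y (?B \<inter> A) + sum y (?B - A)"
    by (rule sum.Int_Diff) simp
  moreover have "sum y A = sum y (A \<inter> ?B) + sum y (A - ?B)"
    by (rule sum.Int_Diff) (rule fin)
  ultimately show ?thesis by (simp add: Int_commute)
qed

lemma sum_const_interval:
  fixes y :: "nat \<Rightarrow> real"
  assumes "\<And>x. x \<in> {a..b} \<Longrightarrow> y x = c" "a \<le> b + 1"
  shows "sum y {a..b} = (real b + 1 - real a) * c"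
proof -
  have "sum y {a..b} = (\<Sum>x\<in>{a..b}. c)" using assms(1) by (rule sum.cong[OF refl])
  also have "\<dots> = (real b + 1 - real a) * c" using assms(2) by (simp add: of_nat_diff)
  finally show ?thesis .
qed

lemma sum_blocks:
  fixes f :: "nat \<Rightarrow> 'a::comm_monoid_add"
  assumes "mono e" "e 0 = (0::nat)"
  shows "sum f {1..e m} = (\<Sum>j<m. sum f {e j + 1..e (Suc j)})"
proof (induction m)
  case 0 then show ?case by (simp add: assms)
next
  case (Suc m)
  have "e m \<le> e (Suc m)" using assms(1) by (simp add: monoD)
  then have "{1..e (Suc m)} = {1..e m} \<union> {e m + 1..e (Suc m)}" by auto
  then have "sum f {1..e (Suc m)} = sum f {1..e m} + sum f {e m + 1..e (Suc m)}"
    by (simp add: sum.union_disjoint)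
  then show ?case using Suc by simp
qed

text \<open>
  The step function with value \<open>c j\<close> on \<open>{e j + 1..e (j + 1)}\<close> for \<open>j < m\<close>, and 0 after \<open>e m\<close>. The block of
  \<open>x\<close> is found by a least index so that monotonicity in \<open>x\<close> is immediate.
\<close>

definition block_fun :: "(nat \<Rightarrow> nat) \<Rightarrow> (nat \<Rightarrow> real) \<Rightarrow> nat \<Rightarrow> nat \<Rightarrow> real" where
  "block_fun e c m x = (if x \<le> e m then c (LEAST j. x \<le> e (Suc j)) else 0)"

lemma block_fun_eq:
  assumes "mono e" "j < m" "e j < x" "x \<le> e (Suc j)"
  shows "block_fun e c m x = c j"
proof -
  have "(LEAST j. x \<le> e (Suc j)) = j"
  proof (rule Least_equality)
    fix k assume k: "x \<le> e (Suc k)"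
    show "j \<le> k"
    proof (rule ccontr)
      assume "\<not> j \<le> k"
      then have "e (Suc k) \<le> e j" using monoD[OF assms(1)] by simp
      then show False using k assms(3) by simp
    qed
  qed (rule assms)
  moreover have "e (Suc j) \<le> e m" using monoD[OF assms(1)] assms(2) by simp
  ultimately show ?thesis using assms(4) by (simp add: block_fun_def)
qed

lemma Least_block_less:
  assumes "mono e" "1 \<le> m" "x \<le> e m"
  shows "(LEAST j. x \<le> e (Suc j)) < m"
proof -
  have "(LEAST j. x \<le> e (Suc j)) \<le> m - 1" using assms by (intro Least_le) simp
  then show ?thesis using assms by simp
qed

lemma block_fun_nonneg:
  assumes "mono e" "1 \<le> m" "\<And>j. j < m \<Longrightarrow> 0 \<le> c j"
  shows "0 \<le> block_fun e c m x"
  using assms Least_block_less[OF assms(1,2)] by (simp add: block_fun_def)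

lemma block_fun_antimono:
  assumes e: "mono e" and m: "1 \<le> m" and nonneg: "\<And>j. j < m \<Longrightarrow> 0 \<le> c j"
    and anti: "\<And>j k. j \<le> k \<Longrightarrow> k < m \<Longrightarrow> c k \<le> c j" and ab: "a \<le> b"
  shows "block_fun e c m b \<le> block_fun e c m a"
proof (cases "b \<le> e m")
  case True
  have "b \<le> e (Suc (LEAST j. b \<le> e (Suc j)))"
    by (rule LeastI[of _ "m - 1"]) (use True m in simp)
  then have "(LEAST j. a \<le> e (Suc j)) \<le> (LEAST j. b \<le> e (Suc j))"
    using ab by (intro Least_le) simp
  from anti[OF this Least_block_less[OF e m True]] show ?thesis
    using True ab by (simp add: block_fun_def)
next
  case False
  then show ?thesis using block_fun_nonneg[of e m c a, OF e m nonneg] by (simp add: block_fun_def)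
qed

lemma sum_block_fun:
  assumes e: "mono e" "e 0 = 0" and N: "e m \<le> N"
  shows "sum (block_fun e c m) {1..N} = (\<Sum>j<m. real (e (Suc j) - e j) * c j)"
proof -
  have "sum (block_fun e c m) {1..N} = sum (block_fun e c m) {1..e m}"
    by (rule sum.mono_neutral_right) (use N in \<open>auto simp: block_fun_def\<close>)
  also have "\<dots> = (\<Sum>j<m. sum (block_fun e c m) {e j + 1..e (Suc j)})"
    by (rule sum_blocks[OF e])
  also have "\<dots> = (\<Sum>j<m. sum (\<lambda>_. c j) {e j + 1..e (Suc j)})"
    by (intro sum.cong refl block_fun_eq[OF e(1)]) auto
  finally show ?thesis by simp
qed

section \<open>Associated primes of a square-free principal Borel ideal\<close>

lemma lookup_sum_var:
  fixes j :: "nat \<Rightarrow> nat"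
  assumes "inj_on j {1..q::nat}"
  shows "Poly_Mapping.lookup (\<Sum>p=1..q. var (j p)) x = (if x \<in> j ` {1..q} then 1 else 0)"
proof -
  have "(\<Sum>p=1..q. var (j p)) = (\<Sum>y\<in>j ` {1..q}. var y)"
    using sum.reindex[OF assms, of var] by simp
  then have "Poly_Mapping.lookup (\<Sum>p=1..q. var (j p)) x = (\<Sum>y\<in>j ` {1..q}. if y = x then 1 else 0)"
    by (simp only: lookup_sum var_def lookup_single when_def)
  also have "\<dots> = (if x \<in> j ` {1..q} then 1 else 0)"
    by (rule sum.delta) simp
  finally show ?thesis .
qed

lemma keys_sum_var:
  fixes j :: "nat \<Rightarrow> nat"
  assumes "inj_on j {1..q::nat}"
  shows "Poly_Mapping.keys (\<Sum>p=1..q. var (j p)) = j ` {1..q}"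
  unfolding set_eq_iff in_keys_iff lookup_sum_var[OF assms] by simp

lemma weight_sum_list: "weight B (sum_list us) = sum_list (map (weight B) us)"
  by (induction us) (auto simp: weight_add, simp add: weight_def)

text \<open>
  Replacing \<open>x\<^sub>b\<close> by \<open>x\<^sub>a\<close> with \<open>a < b\<close> cannot lower the degree in \<open>x\<^sub>1, \<dots>, x\<^sub>c\<close>.
\<close>

lemma borel_move_weight:
  assumes "borel_move m u"
  shows "weight {1..c} m \<le> weight {1..c} u"
proof -
  obtain ps where ps: "\<forall>(a, b)\<in>set ps. 1 \<le> a \<and> a < b \<and> b \<in> Poly_Mapping.keys m"
    and eq: "u + sum_list (map (\<lambda>(a, b). var b) ps) = m + sum_list (map (\<lambda>(a, b). var a) ps)"
    using assms by (auto simp: borel_move_def)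
  have "(\<Sum>(a, b)\<leftarrow>ps. weight {1..c} (var b)) \<le> (\<Sum>(a, b)\<leftarrow>ps. weight {1..c} (var a))"
    using ps by (intro sum_list_mono) (auto simp: weight_var)
  moreover have "weight {1..c} u + (\<Sum>(a, b)\<leftarrow>ps. weight {1..c} (var b))
      = weight {1..c} m + (\<Sum>(a, b)\<leftarrow>ps. weight {1..c} (var a))"
    using arg_cong[OF eq, of "weight {1..c}"]
    by (simp add: weight_add weight_sum_list case_prod_unfold comp_def)
  ultimately show ?thesis by linarith
qed

lemma borel_move_keys:
  assumes "borel_move m u" "x \<in> Poly_Mapping.keys u"
  shows "x \<in> Poly_Mapping.keys m \<or> (\<exists>b\<in>Poly_Mapping.keys m. 1 \<le> x \<and> x < b)"
proof -
  obtain ps where ps: "\<forall>(a, b)\<in>set ps. 1 \<le> a \<and> a < b \<and> b \<in> Poly_Mapping.keys m"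
    and eq: "u + sum_list (map (\<lambda>(a, b). var b) ps) = m + sum_list (map (\<lambda>(a, b). var a) ps)"
    using assms(1) by (auto simp: borel_move_def)
  have keys: "Poly_Mapping.keys (sum_list us) = (\<Union>u\<in>set us. Poly_Mapping.keys u)" for us :: "monom list"
    by (induction us) (auto simp: keys_add_monom)
  have "x \<in> Poly_Mapping.keys (m + sum_list (map (\<lambda>(a, b). var a) ps))"
    using assms(2) by (simp flip: eq add: keys_add_monom)
  then show ?thesis using ps by (force simp: keys_add_monom keys)
qed

lemma card_keys_eq_weight:
  assumes "squarefree_monom u" and fin: "finite B"
  shows "card (Poly_Mapping.keys u \<inter> B) = weight B u"
proof -
  have "Poly_Mapping.lookup u x = (if x \<in> Poly_Mapping.keys u then 1 else 0)" for x
  proof -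
    have "Poly_Mapping.lookup u x \<le> 1" using assms(1) by (simp add: squarefree_monom_def)
    then have "Poly_Mapping.lookup u x = 0 \<or> Poly_Mapping.lookup u x = 1" by linarith
    then show ?thesis unfolding in_keys_iff by fastforce
  qed
  then have "weight B u = (\<Sum>x\<in>B. if x \<in> Poly_Mapping.keys u then 1 else 0)"
    by (simp add: weight_def)
  then show ?thesis using fin by (simp add: sum.If_cases Int_commute)
qed

text \<open>
  A set has at least \<open>p\<close> elements in \<open>{1..i p}\<close> iff it meets all subsets of \<open>{1..i p}\<close> of this size, which is
  the height of the prime ideals that these subsets generate.
\<close>

definition prime_height :: "(nat \<Rightarrow> nat) \<Rightarrow> nat \<Rightarrow> nat" where
  "prime_height i p = i p + 1 - p"

text \<open>
  The sets for one \<open>p\<close> may contain sets for another, so not all of them give minimal primes.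
\<close>

definition prime_supports :: "(nat \<Rightarrow> nat) \<Rightarrow> nat \<Rightarrow> nat set set" where
  "prime_supports i s = {A. \<exists>p\<in>{1..s}. A \<subseteq> {1..i p} \<and> card A = prime_height i p}"

locale squarefree_monomial =
  fixes i :: "nat \<Rightarrow> nat" and s :: nat
  assumes s_pos: "1 \<le> s" and i_mono: "strict_mono_on {1..s} i" and i_pos: "1 \<le> i 1"
begin

lemma i_less: "1 \<le> p \<Longrightarrow> p < q \<Longrightarrow> q \<le> s \<Longrightarrow> i p < i q"
  using i_mono by (auto simp: strict_mono_on_def)

lemma i_le: "1 \<le> p \<Longrightarrow> p \<le> q \<Longrightarrow> q \<le> s \<Longrightarrow> i p \<le> i q"
  using i_less[of p q] by (cases "p = q") auto

lemma i_gap: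
  assumes "1 \<le> p" "p \<le> q" "q \<le> s"
  shows "i p + (q - p) \<le> i q"
  using assms(2,3)
proof (induction q rule: dec_induct)
  case (step q)
  then show ?case using i_less[of q "Suc q"] assms(1) by simp
qed simp

lemma i_ge: "1 \<le> p \<Longrightarrow> p \<le> s \<Longrightarrow> p \<le> i p"
  using i_gap[of 1 p] i_pos by simp

lemma inj_on_i: "inj_on i {1..s}"
  using i_mono by (rule strict_mono_on_imp_inj_on)

lemma prime_height_pos: "1 \<le> p \<Longrightarrow> p \<le> s \<Longrightarrow> 1 \<le> prime_height i p"
  using i_ge[of p] by (simp add: prime_height_def)

lemma prime_height_mono: "1 \<le> p \<Longrightarrow> p \<le> q \<Longrightarrow> q \<le> s \<Longrightarrow> prime_height i p \<le> prime_height i q"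
  using i_gap[of p q] i_ge[of p] by (simp add: prime_height_def)

lemma real_prime_height:
  "1 \<le> p \<Longrightarrow> p \<le> s \<Longrightarrow> real (prime_height i p) = real (i p) - real p + 1"
  using i_ge[of p] by (simp add: prime_height_def of_nat_diff)

lemma prime_supports_subset:
  assumes "i s \<le> n" "A \<in> prime_supports i s"
  shows "A \<subseteq> {1..n}"
proof -
  obtain p where p: "p \<in> {1..s}" "A \<subseteq> {1..i p}" using assms(2) by (auto simp: prime_supports_def)
  then have "i p \<le> n" using i_le[of p s] assms(1) by simp
  then show ?thesis using p(2) by auto
qed

text \<open>
  A set of \<open>i p - p + 1\<close> elements of \<open>{1..i p}\<close> that misses \<open>K\<close> exists iff at most \<open>p - 1\<close> elements of
  \<open>{1..i p}\<close> belong to \<open>K\<close>.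
\<close>

lemma hits_prime_supports_iff:
  "(\<forall>A\<in>prime_supports i s. A \<inter> K \<noteq> {}) \<longleftrightarrow> (\<forall>p\<in>{1..s}. p \<le> card (K \<inter> {1..i p}))"
proof -
  have card: "card ({1..i p} - K) = i p - card (K \<inter> {1..i p})" for p
    using card_Diff_subset_Int[of "{1..i p}" K] by (simp add: Int_commute)
  show ?thesis
  proof
    assume hit: "\<forall>A\<in>prime_supports i s. A \<inter> K \<noteq> {}"
    show "\<forall>p\<in>{1..s}. p \<le> card (K \<inter> {1..i p})"
    proof (rule ballI, rule ccontr)
      fix p assume p: "p \<in> {1..s}" and "\<not> p \<le> card (K \<inter> {1..i p})"
      then have "prime_height i p \<le> card ({1..i p} - K)"
        using i_ge[of p] unfolding prime_height_def card by auto
      then obtain A where "A \<subseteq> {1..i p} - K" "card A = prime_height i p"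
        by (rule obtain_subset_with_card_n)
      then show False using hit p unfolding prime_supports_def by blast
    qed
  next
    assume cnt: "\<forall>p\<in>{1..s}. p \<le> card (K \<inter> {1..i p})"
    show "\<forall>A\<in>prime_supports i s. A \<inter> K \<noteq> {}"
    proof (intro ballI notI)
      fix A assume "A \<in> prime_supports i s" and disj: "A \<inter> K = {}"
      then obtain p where p: "p \<in> {1..s}" "A \<subseteq> {1..i p}" "card A = prime_height i p"
        by (auto simp: prime_supports_def)
      have "card A \<le> card ({1..i p} - K)" using p(2) disj by (intro card_mono) auto
      moreover have "p \<le> card (K \<inter> {1..i p})" using cnt p(1) by blast
      ultimately show False using p i_ge[of p] unfolding card prime_height_def by auto
    qed
  qed
qed

text \<open>
  The representatives can be chosen greedily: the \<open>q\<close> earlier choices cannot exhaust the at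
  least \<open>q + 1\<close> elements available at step \<open>q + 1\<close>.
\<close>

lemma exists_distinct_representatives:
  assumes "\<And>p. p \<in> {1..q} \<Longrightarrow> p \<le> card (K \<inter> {1..i p})"
  shows "\<exists>j. inj_on j {1..q} \<and> (\<forall>p\<in>{1..q}. j p \<in> K \<and> 1 \<le> j p \<and> j p \<le> i p)"
  using assms
proof (induction q)
  case (Suc q)
  have "p \<le> card (K \<inter> {1..i p})" if "p \<in> {1..q}" for p using Suc.prems[of p] that by simp
  then obtain j where j: "inj_on j {1..q}" "\<forall>p\<in>{1..q}. j p \<in> K \<and> 1 \<le> j p \<and> j p \<le> i p"
    using Suc.IH by blast
  have "card (j ` {1..q}) < card (K \<inter> {1..i (Suc q)})"
    using card_image[OF j(1)] Suc.prems[of "Suc q"] by simp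
  then have "\<not> K \<inter> {1..i (Suc q)} \<subseteq> j ` {1..q}"
    using card_mono[of "j ` {1..q}" "K \<inter> {1..i (Suc q)}"] by auto
  then obtain x where "x \<in> K \<inter> {1..i (Suc q)}" "x \<notin> j ` {1..q}" by blast
  then have x: "x \<in> K" "1 \<le> x" "x \<le> i (Suc q)" "x \<notin> j ` {1..q}" by simp_all
  have Suc_q: "{1..Suc q} = insert (Suc q) {1..q}" by auto
  let ?j = "j(Suc q := x)"
  have j_eq: "?j p = j p" if "p \<in> {1..q}" for p using that by simp
  have "inj_on ?j {1..q}" using j(1) inj_on_cong[of "{1..q}" ?j j] j_eq by blast
  moreover have "?j ` {1..q} = j ` {1..q}" using j_eq by (rule image_cong[OF refl])
  ultimately have "inj_on ?j {1..Suc q}"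
    unfolding Suc_q using x(4) by (simp add: inj_on_insert)
  moreover have "\<forall>p\<in>{1..Suc q}. ?j p \<in> K \<and> 1 \<le> ?j p \<and> ?j p \<le> i p"
    unfolding Suc_q using j(2) x by simp
  ultimately show ?case by blast
qed auto

lemma keys_monom_of: "Poly_Mapping.keys (monom_of i s) = i ` {1..s}"
  unfolding monom_of_def by (rule keys_sum_var[OF inj_on_i])

lemma squarefree_monom_of: "squarefree_monom (monom_of i s)"
  unfolding squarefree_monom_def monom_of_def lookup_sum_var[OF inj_on_i] by simp

lemma borel_generator_counts:
  assumes "borel_move (monom_of i s) u" "squarefree_monom u" "p \<in> {1..s}"
  shows "p \<le> card (Poly_Mapping.keys u \<inter> {1..i p})"
proof -
  have "i ` {1..p} \<subseteq> i ` {1..s} \<inter> {1..i p}"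
    using assms(3) i_le i_ge by (fastforce intro: order_trans)
  then have "card (i ` {1..p}) \<le> card (i ` {1..s} \<inter> {1..i p})" by (intro card_mono) auto
  also have "card (i ` {1..p}) = p"
    using inj_on_subset[OF inj_on_i, of "{1..p}"] assms(3) by (simp add: card_image)
  also have "card (i ` {1..s} \<inter> {1..i p}) = weight {1..i p} (monom_of i s)"
    using card_keys_eq_weight[OF squarefree_monom_of] by (simp add: keys_monom_of)
  also have "\<dots> \<le> weight {1..i p} u" by (rule borel_move_weight[OF assms(1)])
  also have "\<dots> = card (Poly_Mapping.keys u \<inter> {1..i p})"
    using card_keys_eq_weight[OF assms(2)] by simp
  finally show ?thesis .
qed

text \<open>
  Distinct representatives \<open>j p \<le> i p\<close> in the support of \<open>u\<close> multiply to a square-free Borel move of \<open>m\<close>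
  that divides \<open>u\<close>.
\<close>

lemma borel_generator_of_counts:
  assumes "\<forall>p\<in>{1..s}. p \<le> card (Poly_Mapping.keys u \<inter> {1..i p})"
  shows "\<exists>g v. borel_move (monom_of i s) g \<and> squarefree_monom g \<and> u = g + v"
proof -
  obtain j where j: "inj_on j {1..s}" "\<forall>p\<in>{1..s}. j p \<in> Poly_Mapping.keys u \<and> 1 \<le> j p \<and> j p \<le> i p"
    using exists_distinct_representatives[OF bspec[OF assms]] by metis
  define g where "g = (\<Sum>p=1..s. var (j p))"
  have lg: "Poly_Mapping.lookup g x = (if x \<in> j ` {1..s} then 1 else 0)" for x
    unfolding g_def by (rule lookup_sum_var[OF j(1)])
  define qs where "qs = [1..<Suc s]"
  have set_qs: "set qs = {1..s}" by (auto simp: qs_def)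
  have list: "(\<Sum>p=1..s. f p) = (\<Sum>p\<leftarrow>qs. f p)" for f :: "nat \<Rightarrow> monom"
    unfolding qs_def by (simp only: interv_sum_list_conv_sum_set_nat atLeastLessThanSuc_atLeastAtMost set_upt)
  \<comment> \<open>A Borel move only lists pairs with \<open>a < b\<close>, so the indices with \<open>j p = i p\<close> are set aside.\<close>
  define same moved where "same = filter (\<lambda>p. \<not> j p < i p) qs" and "moved = filter (\<lambda>p. j p < i p) qs"
  have split: "(\<Sum>p\<leftarrow>qs. f p) = (\<Sum>p\<leftarrow>moved. f p) + (\<Sum>p\<leftarrow>same. f p)"
    for f :: "nat \<Rightarrow> monom"
    unfolding same_def moved_def by (induction qs) (auto simp: algebra_simps)
  have "var (j p) = var (i p)" if "p \<in> set same" for p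
  proof -
    have "p \<in> {1..s}" "\<not> j p < i p" using that set_qs by (auto simp: same_def)
    then have "j p = i p" using j(2) by (meson le_neq_implies_less)
    then show ?thesis by simp
  qed
  then have same: "(\<Sum>p\<leftarrow>same. var (j p)) = (\<Sum>p\<leftarrow>same. var (i p))"
    by (intro arg_cong[of _ _ sum_list] map_cong refl)
  define ps where "ps = map (\<lambda>p. (j p, i p)) moved"
  have sum_ps: "(\<Sum>(a, b)\<leftarrow>ps. var a) = (\<Sum>p\<leftarrow>moved. var (j p))"
    "(\<Sum>(a, b)\<leftarrow>ps. var b) = (\<Sum>p\<leftarrow>moved. var (i p))"
    by (simp_all add: ps_def comp_def)
  have "borel_move (monom_of i s) g"
    unfolding borel_move_def
  proof (intro exI[of _ ps] conjI)
    show "\<forall>(a, b)\<in>set ps. 1 \<le> a \<and> a < b \<and> b \<in> Poly_Mapping.keys (monom_of i s)"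
    proof (clarify)
      fix a b assume "(a, b) \<in> set ps"
      then obtain p where p: "p \<in> {1..s}" "a = j p" "b = i p" "j p < i p"
        by (auto simp: ps_def moved_def set_qs)
      then show "1 \<le> a \<and> a < b \<and> b \<in> Poly_Mapping.keys (monom_of i s)"
        using j(2) unfolding keys_monom_of by blast
    qed
    have "g = (\<Sum>p\<leftarrow>moved. var (j p)) + (\<Sum>p\<leftarrow>same. var (j p))"
      unfolding g_def list by (rule split)
    moreover have "monom_of i s = (\<Sum>p\<leftarrow>moved. var (i p)) + (\<Sum>p\<leftarrow>same. var (i p))"
      unfolding monom_of_def list by (rule split)
    ultimately show "g + (\<Sum>(a, b)\<leftarrow>ps. var b) = monom_of i s + (\<Sum>(a, b)\<leftarrow>ps. var a)"
      unfolding sum_ps same by (simp only: ac_simps)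
  qed
  moreover have "squarefree_monom g" unfolding squarefree_monom_def lg by simp
  moreover have "u = g + (u - g)"
  proof (rule poly_mapping_eqI)
    fix x
    have "Poly_Mapping.lookup g x \<le> Poly_Mapping.lookup u x"
    proof (cases "x \<in> j ` {1..s}")
      case True
      then have "x \<in> Poly_Mapping.keys u" using j(2) by blast
      then show ?thesis unfolding lg in_keys_iff by simp
    next
      case False
      then show ?thesis unfolding lg by simp
    qed
    then show "Poly_Mapping.lookup u x = Poly_Mapping.lookup (g + (u - g)) x"
      by (simp add: lookup_add lookup_minus)
  qed
  ultimately show ?thesis by blast
qed

lemma sfBorel_eq:
  assumes n: "i s \<le> n"
  shows "sfBorel n (monom_of i s)
    = (monomial_ideal n (\<lambda>u. \<forall>A\<in>prime_supports i s. 1 \<le> weight A u) :: ('k::field) mpoly set)"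
proof -
  let ?G = "{g. borel_move (monom_of i s) g \<and> squarefree_monom g}"
  have fin: "finite A" if "A \<in> prime_supports i s" for A
    using prime_supports_subset[OF n that] finite_subset by blast
  have Q: "(\<forall>A\<in>prime_supports i s. 1 \<le> weight A u) \<longleftrightarrow>
      (\<forall>p\<in>{1..s}. p \<le> card (Poly_Mapping.keys u \<inter> {1..i p}))"
    for u :: monom
    using hits_prime_supports_iff[of "Poly_Mapping.keys u"] weight_pos_iff[OF fin] by simp
  have "genideal (poly_ring n) ((\<lambda>g. Poly_Mapping.single g (1::'k)) ` ?G)
      = monomial_ideal n (\<lambda>u. \<forall>A\<in>prime_supports i s. 1 \<le> weight A u)"
  proof (rule genideal_monomials)
    fix g assume g: "g \<in> ?G"
    show "Poly_Mapping.keys g \<subseteq> {1..n}"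
    proof
      fix x assume "x \<in> Poly_Mapping.keys g"
      then consider p where "p \<in> {1..s}" "x = i p" | p where "p \<in> {1..s}" "1 \<le> x" "x < i p"
        using borel_move_keys[of "monom_of i s" g x] g by (auto simp: keys_monom_of)
      then show "x \<in> {1..n}"
      proof cases
        case 1
        then show ?thesis using i_le[of p s] i_ge[of p] n by simp
      next
        case 2
        then show ?thesis using i_le[of p s] n by simp
      qed
    qed
  next
    fix u :: monom
    show "(\<forall>A\<in>prime_supports i s. 1 \<le> weight A u) \<longleftrightarrow> (\<exists>g\<in>?G. \<exists>v. u = g + v)"
      unfolding Q
    proof
      assume "\<exists>g\<in>?G. \<exists>v. u = g + v"
      then obtain g v where g: "g \<in> ?G" "u = g + v" by blast
      show "\<forall>p\<in>{1..s}. p \<le> card (Poly_Mapping.keys u \<inter> {1..i p})"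
      proof
        fix p assume p: "p \<in> {1..s}"
        have "p \<le> card (Poly_Mapping.keys g \<inter> {1..i p})" using borel_generator_counts g p by blast
        also have "\<dots> \<le> card (Poly_Mapping.keys u \<inter> {1..i p})"
          by (intro card_mono) (auto simp: g keys_add_monom)
        finally show "p \<le> card (Poly_Mapping.keys u \<inter> {1..i p})" .
      qed
    qed (use borel_generator_of_counts in blast)
  next
    show "up_closed (\<lambda>u. \<forall>A\<in>prime_supports i s. 1 \<le> weight A u)"
      unfolding up_closed_def weight_add using trans_le_add1 by blast
  qed
  moreover have "(\<lambda>g. Poly_Mapping.single g (1::'k)) ` ?G
      = {Poly_Mapping.single g 1 | g. borel_move (monom_of i s) g \<and> squarefree_monom g}" by blast
  ultimately show ?thesis by (simp only: sfBorel_def)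
qed

end

section \<open>The linear program of a chain of indices\<close>

text \<open>
  What the solution of the linear program uses about \<open>T(m)\<close> and about the chain \<open>u\<close>, which stands for
  \<open>T'(m)\<close> in increasing order followed by \<open>t\<^sub>l\<close>. The members of \<open>T\<close> strictly between \<open>u j\<close> and
  \<open>u (j + 1)\<close> are at most \<open>i (u j)\<close>, so that the interval \<open>{x..i x}\<close> starts in the block that ends at \<open>i (u j)\<close>.
\<close>

locale linear_program_chain = squarefree_monomial +
  fixes T :: "nat set" and u :: "nat \<Rightarrow> nat" and R :: nat
  assumes s_in_T: "s \<in> T" and T_subset: "T \<subseteq> {1..s}"
    and not_in_T: "\<And>p. p \<in> {1..s} \<Longrightarrow> p \<notin> T \<Longrightarrow> i (Suc p) = Suc (i p)"
    and u_in_T: "\<And>j. j \<le> Suc R \<Longrightarrow> u j \<in> T"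
    and gap: "\<And>j. j \<le> R \<Longrightarrow> i (u j) < u (Suc j)"
    and last_ge: "s \<le> i (u (Suc R))"
    and first_le: "\<And>x. x \<in> T \<Longrightarrow> u 0 \<le> x"
    and between_le: "\<And>x j. x \<in> T \<Longrightarrow> j \<le> R \<Longrightarrow> u j < x \<Longrightarrow> x < u (Suc j) \<Longrightarrow> x \<le> i (u j)"
    and between_ineq: "\<And>x j. x \<in> T \<Longrightarrow> j \<le> R \<Longrightarrow> u j < x \<Longrightarrow> x < u (Suc j) \<Longrightarrow>
      1 \<le> (real (i (u j)) + 1 - real x) / real (prime_height i (u j))
        + (real (i x) - real (i (u j))) / real (prime_height i (u (Suc j)))"
begin

definition chain_height :: "nat \<Rightarrow> nat" where
  "chain_height j = prime_height i (u j)"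

text \<open>
  The last block is cut off so that exactly \<open>chain_height (Suc R)\<close> of its indices are at least \<open>s\<close>. With
  weight \<open>1 / chain_height (Suc R)\<close> each, these sum to 1 and make the constraint for \<open>s\<close> tight.
\<close>

definition block_end :: "nat \<Rightarrow> nat" where
  "block_end j = (if j = 0 then 0 else if j \<le> Suc R then i (u (j - 1)) else s + chain_height (Suc R) - 1)"

definition optimum :: real where
  "optimum = (\<Sum>j<R + 2. real (block_end (Suc j) - block_end j) * (1 / real (chain_height j)))"

lemma u_range: "j \<le> Suc R \<Longrightarrow> 1 \<le> u j" "j \<le> Suc R \<Longrightarrow> u j \<le> s"
  using u_in_T T_subset by force+

lemma chain_height_pos: "j \<le> Suc R \<Longrightarrow> 1 \<le> chain_height j"
  unfolding chain_height_def by (intro prime_height_pos u_range)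

lemma i_u: "j \<le> Suc R \<Longrightarrow> i (u j) + 1 = u j + chain_height j"
  using i_ge[of "u j"] u_range[of j] by (simp add: chain_height_def prime_height_def)

lemma u_mono:
  assumes "j \<le> k" "k \<le> Suc R"
  shows "u j \<le> u k"
  using assms
proof (induction k rule: dec_induct)
  case (step k)
  have "u k \<le> i (u k)" using step by (intro i_ge u_range) auto
  also have "\<dots> < u (Suc k)" using step by (intro gap) auto
  finally show ?case using step by simp
qed simp

lemma chain_height_mono: "j \<le> k \<Longrightarrow> k \<le> Suc R \<Longrightarrow> chain_height j \<le> chain_height k"
  unfolding chain_height_def by (intro prime_height_mono u_range u_mono) auto

lemma block_end_0: "block_end 0 = 0"
  and block_end_Suc: "j \<le> R \<Longrightarrow> block_end (Suc j) = i (u j)"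
  and block_end_last: "block_end (Suc (Suc R)) = s + chain_height (Suc R) - 1"
  by (simp_all add: block_end_def)

lemma block_end_less_u: "j \<le> Suc R \<Longrightarrow> block_end j < u j"
  using u_range(1)[of 0] gap[of "j - 1"] by (cases j) (auto simp: block_end_def)

lemma block_end_R_less: "block_end (Suc R) < s"
  using block_end_less_u[of "Suc R"] u_range(2)[of "Suc R"] by simp

lemma mono_block_end: "mono block_end"
proof (rule incseq_SucI)
  fix j
  consider "j \<le> R" | "j = Suc R" | "Suc (Suc R) \<le> j" by linarith
  then show "block_end j \<le> block_end (Suc j)"
  proof cases
    case 1
    then have "block_end j < u j" by (intro block_end_less_u) simp
    also have "u j \<le> i (u j)" using 1 by (intro i_ge u_range) auto
    finally show ?thesis using 1 by (simp add: block_end_Suc)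
  next
    case 2
    then show ?thesis using block_end_R_less chain_height_pos[of "Suc R"] by (simp add: block_end_last)
  next
    case 3
    then show ?thesis by (simp add: block_end_def)
  qed
qed

lemma block_end_last_le: "block_end (R + 2) \<le> i s"
proof -
  have "chain_height (Suc R) \<le> prime_height i s"
    unfolding chain_height_def by (intro prime_height_mono u_range) auto
  then show ?thesis using i_ge[of s] s_pos chain_height_pos[of "Suc R"]
    by (simp add: block_end_last prime_height_def)
qed

definition optimal_weight :: "nat \<Rightarrow> real" where
  "optimal_weight = block_fun block_end (\<lambda>j. 1 / real (chain_height j)) (R + 2)"

lemma optimal_weight_nonneg: "0 \<le> optimal_weight x"
  unfolding optimal_weight_def by (rule block_fun_nonneg[OF mono_block_end]) auto

lemma optimal_weight_antimono: "a \<le> b \<Longrightarrow> optimal_weight b \<le> optimal_weight a"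
  unfolding optimal_weight_def
proof (rule block_fun_antimono[OF mono_block_end])
  fix j k assume "j \<le> k" "k < R + 2"
  then show "1 / real (chain_height k) \<le> 1 / real (chain_height j)"
    using chain_height_mono[of j k] chain_height_pos[of j] by (intro divide_left_mono) auto
qed auto

lemma optimal_weight_eq:
  "j \<le> Suc R \<Longrightarrow> block_end j < x \<Longrightarrow> x \<le> block_end (Suc j) \<Longrightarrow> optimal_weight x = 1 / real (chain_height j)"
  unfolding optimal_weight_def by (rule block_fun_eq[OF mono_block_end]) auto

lemma sum_optimal_weight:
  assumes "i s \<le> n"
  shows "sum optimal_weight {1..n} = optimum"
  unfolding optimal_weight_def optimum_def
  by (rule sum_block_fun[where m = "R + 2"]) (use mono_block_end block_end_0 block_end_last_le assms in auto)

text \<open>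
  From the last member of the chain on, the interval begins with enough indices of the last block. For a
  member \<open>u j\<close> of the chain with \<open>j \<le> R\<close> the interval lies in one block and has sum 1. In between it meets
  the blocks \<open>j\<close> and \<open>j + 1\<close>, and its sum is the left-hand side of the assumed inequality.
\<close>

lemma optimal_weight_segment_T:
  assumes x: "x \<in> T"
  shows "1 \<le> sum optimal_weight {x..i x}"
proof -
  have x_range: "1 \<le> x" "x \<le> s" using x T_subset by auto
  let ?J = "{j. j \<le> Suc R \<and> u j \<le> x}"
  define j where "j = Max ?J"
  have J: "finite ?J" "0 \<in> ?J" using first_le[OF x] by auto
  then have "j \<in> ?J" unfolding j_def by (intro Max_in) auto
  then have j: "j \<le> Suc R" "u j \<le> x" by auto
  have next_j: "x < u (Suc j)" if "j \<le> R"
  proof (rule ccontr)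
    assume "\<not> x < u (Suc j)"
    then have "Suc j \<le> j" unfolding j_def using that J by (intro Max_ge) (auto simp: j_def)
    then show False by simp
  qed
  have lower: "block_end j < x" using block_end_less_u[OF j(1)] j(2) by simp
  show ?thesis
  proof (cases "j = Suc R")
    case True
    have "chain_height (Suc R) \<le> prime_height i x"
      unfolding chain_height_def using j x_range True by (intro prime_height_mono u_range) auto
    then have sub: "x + chain_height (Suc R) - 1 \<le> i x"
      using i_ge[OF x_range] chain_height_pos[of "Suc R"] by (simp add: prime_height_def)
    have "sum optimal_weight {x..x + chain_height (Suc R) - 1}
        = (real (x + chain_height (Suc R) - 1) + 1 - real x) * (1 / real (chain_height (Suc R)))"
    proof (rule sum_const_interval)
      fix y assume "y \<in> {x..x + chain_height (Suc R) - 1}"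
      then show "optimal_weight y = 1 / real (chain_height (Suc R))"
        using lower x_range True by (intro optimal_weight_eq) (auto simp: block_end_last)
    qed simp
    also have "real (x + chain_height (Suc R) - 1) + 1 - real x = real (chain_height (Suc R))"
      using chain_height_pos[of "Suc R"] by (simp add: of_nat_diff)
    also have "\<dots> * (1 / real (chain_height (Suc R))) = 1" using chain_height_pos[of "Suc R"] by simp
    finally have "1 = sum optimal_weight {x..x + chain_height (Suc R) - 1}" by simp
    also have "\<dots> \<le> sum optimal_weight {x..i x}"
      using sub optimal_weight_nonneg by (intro sum_mono2) auto
    finally show ?thesis .
  next
    case False
    then have jR: "j \<le> R" using j by simp
    have part1: "sum optimal_weight {x..i (u j)} = (real (i (u j)) + 1 - real x) * (1 / real (chain_height j))"
      if "x \<le> i (u j) + 1"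
    proof (rule sum_const_interval[OF _ that])
      fix y assume "y \<in> {x..i (u j)}"
      then show "optimal_weight y = 1 / real (chain_height j)"
        using lower jR by (intro optimal_weight_eq) (auto simp: block_end_Suc)
    qed
    show ?thesis
    proof (cases "x = u j")
      case True
      have "real (i (u j)) + 1 - real x = real (chain_height j)"
        using i_u[OF j(1)] True by linarith
      then show ?thesis using part1 i_ge[OF x_range] True chain_height_pos[OF j(1)] by simp
    next
      case False
      then have xj: "u j < x" "x < u (Suc j)" using j next_j[OF jR] by auto
      have le: "x \<le> i (u j)" by (rule between_le[OF x jR xj])
      have ix: "i (u j) < i x" using xj j u_range(1)[OF j(1)] x_range by (intro i_less) auto
      have upper: "i x \<le> block_end (Suc (Suc j))"
      proof (cases "j = R")
        case True
        have "i x < i (u (Suc R))" using xj x_range u_range[of "Suc R"] True by (intro i_less) auto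
        then show ?thesis using True i_u[of "Suc R"] u_range(2)[of "Suc R"] by (simp add: block_end_last)
      next
        case False
        have "i x \<le> i (u (Suc j))" using xj x_range u_range[of "Suc j"] jR by (intro i_le) auto
        then show ?thesis using False jR by (simp add: block_end_Suc)
      qed
      have part2: "sum optimal_weight {i (u j) + 1..i x}
          = (real (i x) + 1 - real (i (u j) + 1)) * (1 / real (chain_height (Suc j)))"
      proof (rule sum_const_interval)
        fix y assume "y \<in> {i (u j) + 1..i x}"
        then show "optimal_weight y = 1 / real (chain_height (Suc j))"
          using upper jR by (intro optimal_weight_eq) (auto simp: block_end_Suc)
      qed (use ix in simp)
      have "{x..i x} = {x..i (u j)} \<union> {i (u j) + 1..i x}" using le ix by auto
      then have "sum optimal_weight {x..i x} = sum optimal_weight {x..i (u j)} + sum optimal_weight {i (u j) + 1..i x}"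
        by (simp only:) (rule sum.union_disjoint, auto)
      then show ?thesis
        using part1 part2 le between_ineq[OF x jR xj] by (simp add: chain_height_def)
    qed
  qed
qed

text \<open>
  For \<open>p \<notin> T\<close> the interval of \<open>p + 1\<close> is that of \<open>p\<close> shifted by one, where the weights are not larger.
\<close>

lemma optimal_weight_segment:
  assumes "1 \<le> p" "p \<le> s"
  shows "1 \<le> sum optimal_weight {p..i p}"
  using assms(2,1)
proof (induction p rule: inc_induct)
  case base
  show ?case by (rule optimal_weight_segment_T[OF s_in_T])
next
  case (step p)
  show ?case
  proof (cases "p \<in> T")
    case True
    then show ?thesis by (rule optimal_weight_segment_T)
  next
    case False
    then have "i (Suc p) = Suc (i p)" using step by (intro not_in_T) auto
    then have "1 \<le> sum optimal_weight {Suc p..Suc (i p)}" using step by simp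
    also have "\<dots> = (\<Sum>x\<in>{p..i p}. optimal_weight (Suc x))" by (rule sum.shift_bounds_cl_Suc_ivl)
    also have "\<dots> \<le> sum optimal_weight {p..i p}" by (intro sum_mono optimal_weight_antimono) simp
    finally show ?thesis .
  qed
qed

lemma optimal_weight_feasible:
  assumes "A \<in> prime_supports i s"
  shows "1 \<le> sum optimal_weight A"
proof -
  obtain p where p: "p \<in> {1..s}" "A \<subseteq> {1..i p}" "card A = prime_height i p"
    using assms by (auto simp: prime_supports_def)
  have "1 \<le> sum optimal_weight {p..i p}" using optimal_weight_segment p(1) by simp
  also have "\<dots> \<le> sum optimal_weight A"
    using p i_ge[of p] optimal_weight_antimono
    by (intro sum_ge_final_segment[where N = "i p"]) (auto simp: prime_height_def)
  finally show ?thesis .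
qed

text \<open>
  A block \<open>j \<le> R\<close> has at least \<open>chain_height j\<close> elements because \<open>u j\<close> exceeds the end of the preceding
  block; hence the constraints for \<open>u j\<close> average over it. What lies beyond these blocks is split into a
  part governed by the constraint for \<open>u (Suc R)\<close> and a rest governed by the one for \<open>s\<close>.
\<close>

lemma optimum_le_feasible:
  fixes z :: "nat \<Rightarrow> real"
  assumes n: "i s \<le> n" and nonneg: "\<And>x. 0 \<le> z x"
    and feas: "\<And>A. A \<in> prime_supports i s \<Longrightarrow> 1 \<le> sum z A"
  shows "optimum \<le> sum z {1..n}"
proof -
  have average: "real (card B) * (1 / real (chain_height j)) \<le> sum z B"
    if j: "j \<le> Suc R" and B: "B \<subseteq> {1..i (u j)}" "chain_height j \<le> card B" for B j
  proof (rule sum_ge_of_subsets)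
    show "finite B" using B(1) finite_subset by blast
    show "1 \<le> chain_height j" by (rule chain_height_pos[OF j])
    fix C assume "C \<subseteq> B" "card C = chain_height j"
    then have "C \<in> prime_supports i s"
      using B(1) u_range[OF j] unfolding prime_supports_def chain_height_def by fastforce
    then show "real (chain_height j) * (1 / real (chain_height j)) \<le> sum z C" using feas[of C] chain_height_pos[OF j] by simp
  qed (rule B(2))
  have initial: "(\<Sum>j<Suc R. real (block_end (Suc j) - block_end j) * (1 / real (chain_height j)))
      \<le> sum z {1..block_end (Suc R)}"
    unfolding sum_blocks[OF mono_block_end block_end_0]
  proof (rule sum_mono)
    fix j assume "j \<in> {..<Suc R}"
    then have j: "j \<le> R" by simp
    have "real (card {block_end j + 1..block_end (Suc j)}) * (1 / real (chain_height j))
        \<le> sum z {block_end j + 1..block_end (Suc j)}"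
    proof (rule average)
      show "chain_height j \<le> card {block_end j + 1..block_end (Suc j)}"
        using block_end_less_u[of j] i_u[of j] j by (simp add: block_end_Suc)
    qed (use j in \<open>auto simp: block_end_Suc\<close>)
    then show "real (block_end (Suc j) - block_end j) * (1 / real (chain_height j))
        \<le> sum z {block_end j + 1..block_end (Suc j)}" by simp
  qed
  let ?a = "block_end (Suc R)" and ?w = "u (Suc R)"
  \<comment> \<open>\<open>c\<close> is chosen so that removing \<open>c\<close> indices from the last block leaves a set on which the
    constraint for \<open>s\<close> applies; since \<open>s \<le> i ?w\<close>, all \<open>c\<close> of them fit into the part \<open>B\<close>
    controlled by the constraint for \<open>?w\<close>.\<close>
  define B where "B = {?a + 1..i ?w}"
  define c where "c = s - 1 - ?a"
  have a_less: "?a < ?w" by (rule block_end_less_u) simp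
  have w: "?w \<le> s" "1 \<le> ?w" "i ?w \<le> i s" using u_range[of "Suc R"] by (auto intro: i_le)
  have "\<exists>C\<subseteq>B. card C = c \<and> real c * (1 / real (chain_height (Suc R))) \<le> sum z C"
  proof (rule exists_subset_sum_ge_average)
    show "finite B" by (simp add: B_def)
    show "c \<le> card B" using last_ge by (simp add: B_def c_def)
    show "real (card B) * (1 / real (chain_height (Suc R))) \<le> sum z B"
    proof (rule average)
      show "chain_height (Suc R) \<le> card B" using a_less i_u[of "Suc R"] by (simp add: B_def)
    qed (auto simp: B_def)
  qed
  then obtain C where C: "C \<subseteq> B" "card C = c" "real c * (1 / real (chain_height (Suc R))) \<le> sum z C" by blast
  have C': "C \<subseteq> {?a + 1..i s}" using C(1) w(3) by (auto simp: B_def)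
  let ?rest = "{?a + 1..i s} - C"
  have "card ?rest = card {?a + 1..i s} - card C"
    using C' by (intro card_Diff_subset) (auto intro: finite_subset)
  also have "\<dots> = prime_height i s"
    using block_end_R_less i_ge[OF s_pos] by (simp add: C(2) c_def prime_height_def)
  finally have "?rest \<in> prime_supports i s"
    unfolding prime_supports_def using s_pos by fastforce
  then have "1 + real c * (1 / real (chain_height (Suc R))) \<le> sum z C + sum z ?rest"
    using feas C(3) by fastforce
  also have "\<dots> = sum z {?a + 1..i s}"
    using sum.subset_diff[OF C', of z] by simp
  finally have last: "1 + real c * (1 / real (chain_height (Suc R))) \<le> sum z {?a + 1..i s}" .
  have "real (block_end (Suc (Suc R)) - ?a) = real (chain_height (Suc R)) + real c"
    using block_end_R_less chain_height_pos[of "Suc R"] by (simp add: block_end_last c_def of_nat_diff)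
  then have "real (block_end (Suc (Suc R)) - ?a) * (1 / real (chain_height (Suc R)))
      = 1 + real c * (1 / real (chain_height (Suc R)))"
    using chain_height_pos[of "Suc R"] by (simp add: add_divide_distrib)
  then have "optimum = (\<Sum>j<Suc R. real (block_end (Suc j) - block_end j) * (1 / real (chain_height j)))
      + (1 + real c * (1 / real (chain_height (Suc R))))"
    by (simp add: optimum_def)
  also have "\<dots> \<le> sum z {1..?a} + sum z {?a + 1..i s}"
    using initial last by (rule add_mono)
  also have "\<dots> = sum z ({1..?a} \<union> {?a + 1..i s})"
    by (rule sum.union_disjoint[symmetric]) auto
  also have "\<dots> \<le> sum z {1..n}"
    using n nonneg block_end_R_less i_ge[OF s_pos] by (intro sum_mono2) auto
  finally show ?thesis .
qed

theorem alpha_ratio_tendsto_optimum: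
  assumes n: "i s \<le> n"
  shows "alpha_ratio n (sfBorel n (monom_of i s) :: ('k::field) mpoly set) \<longlonglongrightarrow> optimum"
  unfolding sfBorel_eq[OF n]
proof (rule waldschmidt_eq_linear_program)
  show "A \<subseteq> {1..n}" if "A \<in> prime_supports i s" for A
    using n that by (rule prime_supports_subset)
  show "0 \<le> optimal_weight x" for x by (rule optimal_weight_nonneg)
  show "1 \<le> sum optimal_weight A" if "A \<in> prime_supports i s" for A using that by (rule optimal_weight_feasible)
  show "sum optimal_weight {1..n} \<le> optimum" using sum_optimal_weight[OF n] by simp
  show "optimum \<le> sum z {1..n}"
    if "\<And>x. 0 \<le> z x" "\<And>A. A \<in> prime_supports i s \<Longrightarrow> 1 \<le> sum z A" for z :: "nat \<Rightarrow> real"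
    using n that by (rule optimum_le_feasible)
qed

lemma optimum_eq:
  "optimum = 1 + (real s - real (i (u R)) - 1) / real (chain_height (Suc R)) + real (i (u 0)) / real (chain_height 0)
    + (\<Sum>j<R. (real (i (u (Suc j))) - real (i (u j))) / real (chain_height (Suc j)))"
proof -
  let ?f = "\<lambda>j. real (block_end (Suc j) - block_end j) * (1 / real (chain_height j))"
  have "real (block_end (Suc (Suc R)) - i (u R)) = real (chain_height (Suc R)) + (real s - real (i (u R)) - 1)"
    using block_end_R_less chain_height_pos[of "Suc R"] by (simp add: block_end_last block_end_Suc of_nat_diff)
  then have last: "?f (Suc R) = 1 + (real s - real (i (u R)) - 1) / real (chain_height (Suc R))"
    using chain_height_pos[of "Suc R"] by (simp add: block_end_Suc add_divide_distrib diff_divide_distrib)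
  have first: "?f 0 = real (i (u 0)) / real (chain_height 0)" by (simp add: block_end_Suc block_end_0)
  have middle: "?f (Suc j) = (real (i (u (Suc j))) - real (i (u j))) / real (chain_height (Suc j))" if "j < R" for j
  proof -
    have "block_end (Suc j) \<le> block_end (Suc (Suc j))" using mono_block_end by (simp add: monoD)
    then show ?thesis using that by (simp add: block_end_Suc of_nat_diff)
  qed
  have "optimum = sum ?f {..<Suc R} + ?f (Suc R)" by (simp add: optimum_def)
  also have "sum ?f {..<Suc R} = ?f 0 + (\<Sum>j<R. ?f (Suc j))" by (rule sum.lessThan_Suc_shift)
  also have "(\<Sum>j<R. ?f (Suc j)) = (\<Sum>j<R. (real (i (u (Suc j))) - real (i (u j))) / real (chain_height (Suc j)))"
    by (intro sum.cong refl middle) simp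
  finally show ?thesis unfolding last first by (simp only: ac_simps)
qed

end

section \<open>The sequences T(m) and T'(m)\<close>

context squarefree_monomial
begin

lemma finite_T_cands: "finite (T_cands i x)"
  by (rule finite_subset[of _ "{..<x}"]) (auto simp: T_cands_def)

lemma T_seq_Suc_in_cands:
  "T_cands i (T_seq i s q) \<noteq> {} \<Longrightarrow> T_seq i s (Suc q) \<in> T_cands i (T_seq i s q)"
  using Max_in[OF finite_T_cands] by simp

lemma T_seq_Suc_less:
  "T_cands i (T_seq i s q) \<noteq> {} \<Longrightarrow> T_seq i s (Suc q) < T_seq i s q"
  using T_seq_Suc_in_cands[of q] unfolding T_cands_def by blast

lemma T_cands_T_last: "T_cands i (T_seq i s (T_last i s)) = {}"
proof -
  have "\<exists>q. T_cands i (T_seq i s q) = {}"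
  proof (rule ccontr)
    assume ne: "\<nexists>q. T_cands i (T_seq i s q) = {}"
    have "T_seq i s q + q \<le> s" for q
    proof (induction q)
      case (Suc q)
      then show ?case using T_seq_Suc_less[of q] ne by (metis Suc_leI add_Suc_right add_Suc add_le_mono1 le_trans)
    qed simp
    from this[of "Suc s"] show False by simp
  qed
  then show ?thesis unfolding T_last_def by (rule LeastI_ex)
qed

lemma T_cands_nonempty: "q < T_last i s \<Longrightarrow> T_cands i (T_seq i s q) \<noteq> {}"
  unfolding T_last_def by (rule not_less_Least)

lemma T_seq_mono:
  assumes "p \<le> q" "q \<le> T_last i s"
  shows "T_seq i s q \<le> T_seq i s p"
  using assms
proof (induction q rule: dec_induct)
  case (step q)
  then have "T_seq i s (Suc q) < T_seq i s q" by (intro T_seq_Suc_less T_cands_nonempty) simp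
  then show ?case using step by simp
qed simp

text \<open>
  An explicit description of \<open>T(m)\<close>: the recursion enumerates the ends of the runs of consecutive
  indices from above, skipping none.
\<close>

lemma T_set_eq: "T_set i s = insert s (T_cands i s)"
proof
  show "T_set i s \<subseteq> insert s (T_cands i s)"
  proof
    fix x assume "x \<in> T_set i s"
    then obtain q where q: "q \<le> T_last i s" "x = T_seq i s q" by (auto simp: T_set_def)
    show "x \<in> insert s (T_cands i s)"
    proof (cases q)
      case 0
      then show ?thesis using q by simp
    next
      case (Suc p)
      then have "x \<in> T_cands i (T_seq i s p)"
        using q T_seq_Suc_in_cands[OF T_cands_nonempty, of p] by simp
      moreover have "T_seq i s p \<le> s" using T_seq_mono[of 0 p] q Suc by simp
      ultimately show ?thesis by (simp add: T_cands_def)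
    qed
  qed
  show "insert s (T_cands i s) \<subseteq> T_set i s"
  proof
    fix x assume x: "x \<in> insert s (T_cands i s)"
    have stop: "T_seq i s (T_last i s) \<le> x"
    proof (rule ccontr)
      assume "\<not> ?thesis"
      then have less: "x < T_seq i s (T_last i s)" by simp
      moreover have "T_seq i s (T_last i s) \<le> s" using T_seq_mono[of 0 "T_last i s"] by simp
      ultimately have "x \<in> T_cands i (T_seq i s (T_last i s))"
        using x by (auto simp: T_cands_def)
      then show False using T_cands_T_last by simp
    qed
    \<comment> \<open>\<open>x\<close> is a candidate at the step before the sequence first drops to \<open>x\<close> or below, so the
      maximal candidate chosen there is \<open>x\<close> itself.\<close>
    define q where "q = (LEAST q. T_seq i s q \<le> x)"
    have q: "T_seq i s q \<le> x" "q \<le> T_last i s"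
      unfolding q_def using stop by (rule LeastI, rule Least_le)
    have "x \<le> T_seq i s q"
    proof (cases q)
      case 0
      then show ?thesis using x by (auto simp: T_cands_def)
    next
      case (Suc p)
      have "x < T_seq i s p" using not_less_Least[of p "\<lambda>q. T_seq i s q \<le> x"] Suc q_def by simp
      moreover have "T_seq i s p \<le> s" using T_seq_mono[of 0 p] q Suc by simp
      ultimately have "x \<in> T_cands i (T_seq i s p)" using x by (auto simp: T_cands_def)
      then show ?thesis using Suc Max_ge[OF finite_T_cands] by simp
    qed
    then show "x \<in> T_set i s" using q by (auto simp: T_set_def)
  qed
qed

lemma T_set_range: "T_set i s \<subseteq> {1..s}"
  using s_pos by (auto simp: T_set_eq T_cands_def)

lemma T_seq_last_le:
  assumes "x \<in> T_set i s"
  shows "T_seq i s (T_last i s) \<le> x"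
  using assms T_seq_mono by (auto simp: T_set_def)

lemma T_seq_in_T: "q \<le> T_last i s \<Longrightarrow> T_seq i s q \<in> T_set i s"
  by (simp add: T_set_def)

lemma consecutive_outside_T:
  assumes "p \<in> {1..s}" "p \<notin> T_set i s"
  shows "i (Suc p) = Suc (i p)"
proof -
  have p: "1 \<le> p" "p < s" using assms by (auto simp: T_set_eq le_less)
  then have "\<not> i p < i (Suc p) - 1" using assms(2) by (simp add: T_set_eq T_cands_def)
  then show ?thesis using i_less[of p "Suc p"] p by simp
qed

lemma finite_T'_cands: "finite (T'_cands i s x)"
  using finite_subset[OF T_set_range] by (simp add: T'_cands_def)

definition T'_stop :: nat where
  "T'_stop = (LEAST j. T'_cands i s (T'_seq i s j) = {})"

lemma T'_length_eq: "T'_length i s = Suc T'_stop"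
  by (simp add: T'_length_def T'_stop_def)

lemma T'_seq_Suc_in_cands:
  "T'_cands i s (T'_seq i s j) \<noteq> {} \<Longrightarrow> T'_seq i s (Suc j) \<in> T'_cands i s (T'_seq i s j)"
  using Min_in[OF finite_T'_cands] by simp

lemma T'_cands_stop: "T'_cands i s (T'_seq i s T'_stop) = {}"
proof -
  have "\<exists>j. T'_cands i s (T'_seq i s j) = {}"
  proof (rule ccontr)
    assume ne: "\<nexists>j. T'_cands i s (T'_seq i s j) = {}"
    have *: "j \<le> T'_seq i s j \<and> T'_seq i s j \<in> T_set i s" for j
    proof (induction j)
      case 0
      then show ?case by (simp add: T_seq_in_T)
    next
      case (Suc j)
      have "T'_seq i s (Suc j) \<in> T'_cands i s (T'_seq i s j)"
        using ne by (intro T'_seq_Suc_in_cands) blast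
      then have mem: "T'_seq i s (Suc j) \<in> T_set i s" "i (T'_seq i s j) < T'_seq i s (Suc j)"
        by (simp_all add: T'_cands_def)
      have "T'_seq i s j \<le> i (T'_seq i s j)"
        using Suc T_set_range by (intro i_ge) auto
      then show ?case using Suc mem by simp
    qed
    have "T'_seq i s (Suc s) \<le> s" using *[of "Suc s"] T_set_range by auto
    then show False using *[of "Suc s"] by simp
  qed
  then show ?thesis unfolding T'_stop_def by (rule LeastI_ex)
qed

lemma T'_seq_Suc: "j < T'_stop \<Longrightarrow> T'_seq i s (Suc j) \<in> T'_cands i s (T'_seq i s j)"
  unfolding T'_stop_def by (intro T'_seq_Suc_in_cands not_less_Least)

lemma T'_seq_props:
  assumes "i (T_seq i s (T_last i s)) < s" "j \<le> T'_stop"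
  shows "T'_seq i s j \<in> T_set i s" "i (T'_seq i s j) < s"
proof -
  have "T'_seq i s j \<in> T_set i s \<and> i (T'_seq i s j) < s"
  proof (cases j)
    case 0
    then show ?thesis using assms by (simp add: T_seq_in_T)
  next
    case (Suc k)
    then have "T'_seq i s j \<in> T'_cands i s (T'_seq i s k)" using assms(2) T'_seq_Suc[of k] by simp
    then show ?thesis using s_pos by (auto simp: T'_cands_def)
  qed
  then show "T'_seq i s j \<in> T_set i s" "i (T'_seq i s j) < s" by auto
qed

text \<open>
  The bound \<open>i x \<le> s - 1\<close> in the choice of the next term is inherited by all smaller \<open>x\<close>, so the next term is
  the least member of \<open>T(m)\<close> beyond \<open>i (T'_seq i s j)\<close> altogether.
\<close>

lemma T'_seq_next_least:
  assumes "i (T_seq i s (T_last i s)) < s" "j < T'_stop"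
    and x: "x \<in> T_set i s" "i (T'_seq i s j) < x"
  shows "T'_seq i s (Suc j) \<le> x"
proof (rule ccontr)
  assume "\<not> T'_seq i s (Suc j) \<le> x"
  then have less: "x < T'_seq i s (Suc j)" by simp
  have "T'_seq i s (Suc j) \<in> T_set i s" "i (T'_seq i s (Suc j)) < s"
    using T'_seq_props[OF assms(1), of "Suc j"] assms(2) by auto
  then have "i x < s" using i_less[of x "T'_seq i s (Suc j)"] less x T_set_range by force
  then have "x \<in> T'_cands i s (T'_seq i s j)" using x by (simp add: T'_cands_def)
  then have "T'_seq i s (Suc j) \<le> x" using Min_le[OF finite_T'_cands] by simp
  then show False using less by simp
qed

text \<open>
  As \<open>T(m)\<close> is enumerated downwards, the largest admissible index \<open>l\<close> gives the least member of \<open>T(m)\<close> beyond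
  the last \<open>i (T'_seq i s T'_stop)\<close>; since \<open>T'(m)\<close> stopped there, its \<open>i\<close>-value is at least \<open>s\<close>.
\<close>

lemma T_seq_l_index:
  assumes first: "i (T_seq i s (T_last i s)) < s"
  defines "w \<equiv> T_seq i s (l_index i s)"
  shows "l_index i s \<le> T_last i s" "i (T'_seq i s T'_stop) < w" "s \<le> i w"
    and "\<And>x. x \<in> T_set i s \<Longrightarrow> i (T'_seq i s T'_stop) < x \<Longrightarrow> w \<le> x"
proof -
  define S where "S = {l \<in> {0..T_last i s}. i (T'_seq i s T'_stop) + 1 \<le> T_seq i s l}"
  have l: "l_index i s = Max S" by (simp add: l_index_def S_def T'_length_eq)
  have fin: "finite S" by (simp add: S_def)
  have "0 \<in> S" using T'_seq_props(2)[OF first, of T'_stop] by (simp add: S_def)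
  then have "l_index i s \<in> S" unfolding l using fin by (intro Max_in) auto
  then show 1: "l_index i s \<le> T_last i s" and 2: "i (T'_seq i s T'_stop) < w"
    by (auto simp: S_def w_def)
  have "w \<in> T_set i s" unfolding w_def by (rule T_seq_in_T[OF 1])
  then show "s \<le> i w"
    using T'_cands_stop 2 s_pos unfolding T'_cands_def by force
  fix x assume x: "x \<in> T_set i s" "i (T'_seq i s T'_stop) < x"
  then obtain p where p: "p \<le> T_last i s" "x = T_seq i s p" by (auto simp: T_set_def)
  then have "p \<in> S" using x by (simp add: S_def)
  then have "p \<le> l_index i s" unfolding l using fin by (intro Max_ge)
  then show "w \<le> x" unfolding w_def p using 1 by (rule T_seq_mono)
qed

text \<open>
  The terms \<open>tk i s j\<close> are numbered downwards, the chain upwards.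
\<close>

lemma tk_chain:
  "tk i s (Suc T'_stop - j) = (if j \<le> T'_stop then T'_seq i s j else T_seq i s (l_index i s))"
  by (auto simp: tk_def T'_length_eq)

lemma linear_program_chain_tk:
  assumes first: "i (T_seq i s (T_last i s)) < s"
    and ineq: "\<And>x j. x \<in> T_set i s \<Longrightarrow> j \<in> {1..Suc T'_stop} \<Longrightarrow> tk i s j < x \<Longrightarrow> x < tk i s (j - 1) \<Longrightarrow>
      1 \<le> (real (i (tk i s j)) - real x + 1) / (real (i (tk i s j)) - real (tk i s j) + 1)
        + (real (i x) - real (i (tk i s j))) / (real (i (tk i s (j - 1))) - real (tk i s (j - 1)) + 1)"
  shows "linear_program_chain i s (T_set i s) (\<lambda>j. tk i s (Suc T'_stop - j)) T'_stop"
proof unfold_locales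
  let ?u = "\<lambda>j. tk i s (Suc T'_stop - j)"
  note l = T_seq_l_index[OF first]
  show "s \<in> T_set i s" by (simp add: T_set_eq)
  show "T_set i s \<subseteq> {1..s}" by (rule T_set_range)
  show "i (Suc p) = Suc (i p)" if "p \<in> {1..s}" "p \<notin> T_set i s" for p
    using that by (rule consecutive_outside_T)
  show u_T: "?u j \<in> T_set i s" if "j \<le> Suc T'_stop" for j
    unfolding tk_chain using T'_seq_props(1)[OF first] T_seq_in_T[OF l(1)] by simp
  show "i (?u j) < ?u (Suc j)" if "j \<le> T'_stop" for j
    unfolding tk_chain using that l(2) T'_seq_Suc[of j] by (auto simp: T'_cands_def le_less)
  show "s \<le> i (?u (Suc T'_stop))"
    unfolding tk_chain using l(3) by simp
  show "?u 0 \<le> x" if "x \<in> T_set i s" for x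
    unfolding tk_chain using T_seq_last_le[OF that] by simp
  fix x j assume x: "x \<in> T_set i s" "j \<le> T'_stop" "?u j < x" "x < ?u (Suc j)"
  show "x \<le> i (?u j)"
  proof (rule ccontr)
    assume "\<not> x \<le> i (?u j)"
    then have less: "i (T'_seq i s j) < x" using x(2) unfolding tk_chain by simp
    have "?u (Suc j) \<le> x"
      unfolding tk_chain
      using less x(1,2) T'_seq_next_least[OF first, of j x] l(4)[of x] by (cases "j = T'_stop") auto
    then show False using x(4) by simp
  qed
  have eq: "Suc T'_stop - j - 1 = Suc T'_stop - Suc j" by simp
  have "1 \<le> (real (i (?u j)) - real x + 1) / (real (i (?u j)) - real (?u j) + 1)
      + (real (i x) - real (i (?u j))) / (real (i (?u (Suc j))) - real (?u (Suc j)) + 1)"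
    using ineq[of x "Suc T'_stop - j"] x unfolding eq by simp
  moreover have height: "real (prime_height i (?u j)) = real (i (?u j)) - real (?u j) + 1"
    if "j \<le> Suc T'_stop" for j
    using u_T[OF that] T_set_range by (intro real_prime_height) auto
  have "j \<le> Suc T'_stop" "Suc j \<le> Suc T'_stop" using x(2) by simp_all
  note height[OF this(1)] height[OF this(2)]
  moreover have "real (i (?u j)) + 1 - real x = real (i (?u j)) - real x + 1" by simp
  ultimately show "1 \<le> (real (i (?u j)) + 1 - real x) / real (prime_height i (?u j))
      + (real (i x) - real (i (?u j))) / real (prime_height i (?u (Suc j)))"
    by (simp only:)
qed

end

theorem theorem5p1:
  fixes n s k l r :: nat and i t \<tau> :: "nat \<Rightarrow> nat" and I :: "('k::field) mpoly set"
  assumes s_pos: "1 \<le> s"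
    and i_mono: "strict_mono_on {1..s} i"
    and i_range: "1 \<le> i 1" "i s \<le> n"
    and t_def: "t = T_seq i s"
    and k_def: "k = T_last i s"
    and T'_defined: "i (t k) < s"
    and r_def: "r = T'_length i s"
    and l_def: "l = l_index i s"
    and tau_def: "\<tau> = tk i s"
    and I_def: "I = sfBorel n (monom_of i s)"
    and ineq: "\<And>p j. p \<in> {0..k} \<Longrightarrow> j \<in> {1..r} \<Longrightarrow> \<tau> j < t p \<Longrightarrow> t p < \<tau> (j - 1) \<Longrightarrow>
        (real (i (\<tau> j)) - real (t p) + 1) / (real (i (\<tau> j)) - real (\<tau> j) + 1)
        + (real (i (t p)) - real (i (\<tau> j))) / (real (i (\<tau> (j - 1))) - real (\<tau> (j - 1)) + 1) \<ge> 1"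
  shows "convergent (alpha_ratio n I) \<and>
         waldschmidt n I =
           1 + (real s - real (i (\<tau> 1)) - 1) / (real (i (t l)) - real (t l) + 1)
             + real (i (t k)) / (real (i (t k)) - real (t k) + 1)
             + (\<Sum>j=1..r-1. (real (i (\<tau> j)) - real (i (\<tau> (j + 1))))
                              / (real (i (\<tau> j)) - real (\<tau> j) + 1))"
proof -
  interpret m: squarefree_monomial i s
    using s_pos i_mono i_range(1) by unfold_locales
  have r: "r = Suc m.T'_stop" unfolding r_def by (rule m.T'_length_eq)
  have chain: "linear_program_chain i s (T_set i s) (\<lambda>j. \<tau> (r - j)) m.T'_stop"
    unfolding tau_def r
  proof (rule m.linear_program_chain_tk)
    show "i (T_seq i s (T_last i s)) < s" using T'_defined by (simp add: t_def k_def)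
    fix x j assume x: "x \<in> T_set i s" and j: "j \<in> {1..Suc m.T'_stop}" "tk i s j < x" "x < tk i s (j - 1)"
    obtain p where "p \<in> {0..k}" "x = t p" using x by (auto simp: T_set_def t_def k_def)
    then show "1 \<le> (real (i (tk i s j)) - real x + 1) / (real (i (tk i s j)) - real (tk i s j) + 1)
        + (real (i x) - real (i (tk i s j))) / (real (i (tk i s (j - 1))) - real (tk i s (j - 1)) + 1)"
      using ineq[of p j] j unfolding tau_def r by simp
  qed
  interpret c: linear_program_chain i s "T_set i s" "\<lambda>j. \<tau> (r - j)" m.T'_stop by (rule chain)
  have ends: "\<tau> (r - 0) = t k" "\<tau> (r - m.T'_stop) = \<tau> 1" "\<tau> (r - Suc m.T'_stop) = t l"
    using m.tk_chain[of 0] by (simp_all add: r t_def k_def tau_def l_def tk_def)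
  have height: "real (c.chain_height j) = real (i (\<tau> (r - j))) - real (\<tau> (r - j)) + 1" if "j \<le> r" for j
    using that r unfolding c.chain_height_def by (intro m.real_prime_height c.u_range) simp_all
  have "(\<Sum>j<m.T'_stop. (real (i (\<tau> (r - Suc j))) - real (i (\<tau> (r - j)))) / real (c.chain_height (Suc j)))
      = (\<Sum>j<m.T'_stop. (real (i (\<tau> (r - Suc j))) - real (i (\<tau> (r - j))))
          / (real (i (\<tau> (r - Suc j))) - real (\<tau> (r - Suc j)) + 1))"
    by (intro sum.cong refl arg_cong2[of _ _ _ _ "(/)"] height) (simp add: r)
  also have "\<dots> = (\<Sum>j=1..r-1. (real (i (\<tau> j)) - real (i (\<tau> (j + 1)))) / (real (i (\<tau> j)) - real (\<tau> j) + 1))"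
    by (rule sum.reindex_bij_witness[of _ "\<lambda>j. m.T'_stop - j" "\<lambda>j. m.T'_stop - j"])
      (auto simp: r Suc_diff_le)
  finally have closed_form: "c.optimum = 1 + (real s - real (i (\<tau> 1)) - 1) / (real (i (t l)) - real (t l) + 1)
             + real (i (t k)) / (real (i (t k)) - real (t k) + 1)
             + (\<Sum>j=1..r-1. (real (i (\<tau> j)) - real (i (\<tau> (j + 1))))
                              / (real (i (\<tau> j)) - real (\<tau> j) + 1))"
    unfolding c.optimum_eq ends using height[of 0] height[of "Suc m.T'_stop"] unfolding ends by (simp add: r)
  have "alpha_ratio n I \<longlonglongrightarrow> c.optimum"
    unfolding I_def using i_range(2) by (rule c.alpha_ratio_tendsto_optimum)
  then show ?thesis
    unfolding waldschmidt_def closed_form by (auto simp: convergent_def dest: limI)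
qed

end
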